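(* For $n\ge2$ and $1\le i\le n$, let $p_{n,i}>0$ and let $(\mathcal{X}_{n,i},K_{n,i},\pi_{n,i})$ be the irreducible reversible Markov chain on $\{0,1,\dots,2n\}$ with parameters $a_{n,i},b_{n,i},c_{n,i}$ described in the context, with $a_{n,i}<b_{n,i}$ and $a_{n,i}+b_{n,i}<1/2$. Assume $$\sum_{i=1}^na_{n,i}=o\Big(\frac1n\Big),\qquad\max_{1\le i\le n}b_{n,i}=o(1),\qquad\max_{1\le i\le n}\frac{a_{n,i}}{b_{n,i}}=O\Big(\frac1n\Big).$$ Let $q_n=p_{n,1}+\cdots+p_{n,n}$, and let $\mathcal{G}=(\mathcal{X}_n,K_n,\pi_n)_n$, where $(\mathcal{X}_n,K_n,\pi_n)$ is the product chain of $(\mathcal{X}_{n,i},K_{n,i},\pi_{n,i})_{i=1}^n$ according to $(p_{n,i}/q_n)_{i=1}^n$. With $\overline\Delta_c(\xi),\underline\Delta_c(\xi)$, $c\in\{0,\infty\}$, as defined in the context, the following are equivalent: (1) For every increasing sequence of positive integers $\xi$, $\overline\Delta_0(\xi)<\overline\Delta_\infty(\xi)$ and $\underline\Delta_0(\xi)<\underline\Delta_\infty(\xi)$. (2) For every increasing sequence of positive integers $\xi$, $\overline\Delta_0(\xi)<\overline\Delta_\infty(\xi)$ or $\underline\Delta_0(\xi)<\underline\Delta_\infty(\xi)$. (3) No subfamily of $\mathcal{G}_c$ has a total variation cutoff.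
   Context: The chain: $K_{n,i}$ has nonzero entries $K_{n,i}(j,j+1)=1-a_{n,i}$ for $j\notin\{n,2n\}$; $K_{n,i}(0,0)=a_{n,i}$; $K_{n,i}(j,j-1)=a_{n,i}$ for $j\ne0$; $K_{n,i}(n,n+1)=b_{n,i}$; $K_{n,i}(n,2n)=1-a_{n,i}-b_{n,i}$; $K_{n,i}(2n,n)=c_{n,i}$; $K_{n,i}(2n,2n)=1-a_{n,i}-c_{n,i}$. It is reversible, i.e. $b_{n,i}c_{n,i}(1-a_{n,i})^{n-1}=(1-a_{n,i}-b_{n,i})a_{n,i}^n$; $\pi_{n,i}$ is its stationary distribution. Let $\hat p_n=\min_{1\le i\le n}p_{n,i}$. For $\delta\in(0,1)$ put $E_{n,\delta}=\{1\le i\le n:p_{n,i}<(1+\delta)\hat p_n\}$ and $B_n(\delta)=\sum_{i\in E_{n,\delta}}b_{n,i}$. For an increasing sequence $\xi=(\xi_n)$ of positive integers put $\overline F_\xi(\delta)=\limsup_nB_{\xi_n}(\delta)$, $\underline F_\xi(\delta)=\liminf_nB_{\xi_n}(\delta)$, and $$\overline\Delta_0(\xi)=\sup\{\delta\in(0,1):\overline F_\xi(\delta)=0\},\quad\underline\Delta_0(\xi)=\sup\{\delta\in(0,1):\underline F_\xi(\delta)=0\},$$ $$\overline\Delta_\infty(\xi)=\inf\{\delta\in(0,1):\overline F_\xi(\delta)=\infty\},\quad\underline\Delta_\infty(\xi)=\inf\{\delta\in(0,1):\underline F_\xi(\delta)=\infty\},$$ with $\sup\emptyset:=0$, $\inf\emptyset:=1$.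 Product chain of $(\mathcal{X}_i,K_i,\pi_i)_{i=1}^n$ according to a probability vector $(w_i)$: state space $\prod\mathcal{X}_i$, stationary distribution $\pi_1\times\cdots\times\pi_n$, transition matrix $\sum_iw_iI_1\otimes\cdots\otimes K_i\otimes\cdots\otimes I_n$. $\mathcal{G}_c$ is the family of continuous time chains with $H_{n,t}=e^{-t(I-K_n)}$; put $d^{(c)}_{n,\mathrm{TV}}(t)=\sup_{x,A}\{H_{n,t}(x,A)-\pi_n(A)\}$. A subfamily of $\mathcal{G}_c$ is indexed by an increasing sequence of integers $\xi$; it has a total variation cutoff if there are $t_n>0$ with $d^{(c)}_{\xi_n,\mathrm{TV}}(at_n)\to0$ for all $a>1$ and $\to1$ for all $a\in(0,1)$. *)

theory Defs
  imports Complex_Main "HOL-Library.FuncSet" "HOL-Library.Extended_Real"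
    "HOL-Library.Liminf_Limsup" "HOL-Library.Landau_Symbols"
begin

text \<open>
  Kernels on a finite set \<open>S\<close> are functions \<open>'a \<Rightarrow> 'a \<Rightarrow> real\<close>; only their values on
  \<open>S \<times> S\<close> matter.  The state space is an explicit carrier set because it varies with the
  index of the family of chains.
\<close>

definition id_kernel :: "'a \<Rightarrow> 'a \<Rightarrow> real" where
  "id_kernel x y = (if x = y then 1 else 0)"

definition kernel_mult ::
    "'a set \<Rightarrow> ('a \<Rightarrow> 'a \<Rightarrow> real) \<Rightarrow> ('a \<Rightarrow> 'a \<Rightarrow> real) \<Rightarrow> 'a \<Rightarrow> 'a \<Rightarrow> real" where
  "kernel_mult S A B x y = (\<Sum>z\<in>S. A x z * B z y)"

primrec kernel_pow ::
    "'a set \<Rightarrow> ('a \<Rightarrow> 'a \<Rightarrow> real) \<Rightarrow> nat \<Rightarrow> 'a \<Rightarrow> 'a \<Rightarrow> real" where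
  "kernel_pow S A 0 = id_kernel"
| "kernel_pow S A (Suc m) = kernel_mult S (kernel_pow S A m) A"

definition kernel_exp :: "'a set \<Rightarrow> ('a \<Rightarrow> 'a \<Rightarrow> real) \<Rightarrow> 'a \<Rightarrow> 'a \<Rightarrow> real" where
  "kernel_exp S A x y = (\<Sum>m. kernel_pow S A m x y / fact m)"

definition stochastic_kernel :: "'a set \<Rightarrow> ('a \<Rightarrow> 'a \<Rightarrow> real) \<Rightarrow> bool" where
  "stochastic_kernel S K \<longleftrightarrow>
     (\<forall>x\<in>S. \<forall>y\<in>S. 0 \<le> K x y) \<and> (\<forall>x\<in>S. (\<Sum>y\<in>S. K x y) = 1)"

definition irreducible_kernel :: "'a set \<Rightarrow> ('a \<Rightarrow> 'a \<Rightarrow> real) \<Rightarrow> bool" where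
  "irreducible_kernel S K \<longleftrightarrow> (\<forall>x\<in>S. \<forall>y\<in>S. \<exists>m. kernel_pow S K m x y > 0)"

definition stationary_distribution ::
    "'a set \<Rightarrow> ('a \<Rightarrow> 'a \<Rightarrow> real) \<Rightarrow> ('a \<Rightarrow> real) \<Rightarrow> bool" where
  "stationary_distribution S K \<pi> \<longleftrightarrow>
     (\<forall>x\<in>S. 0 \<le> \<pi> x) \<and> (\<Sum>x\<in>S. \<pi> x) = 1 \<and> (\<forall>y\<in>S. (\<Sum>x\<in>S. \<pi> x * K x y) = \<pi> y)"

definition reversible_wrt ::
    "'a set \<Rightarrow> ('a \<Rightarrow> 'a \<Rightarrow> real) \<Rightarrow> ('a \<Rightarrow> real) \<Rightarrow> bool" where
  "reversible_wrt S K \<pi> \<longleftrightarrow> (\<forall>x\<in>S. \<forall>y\<in>S. \<pi> x * K x y = \<pi> y * K y x)"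

definition irreducible_reversible_chain ::
    "'a set \<Rightarrow> ('a \<Rightarrow> 'a \<Rightarrow> real) \<Rightarrow> ('a \<Rightarrow> real) \<Rightarrow> bool" where
  "irreducible_reversible_chain S K \<pi> \<longleftrightarrow>
     finite S \<and> stochastic_kernel S K \<and> irreducible_kernel S K \<and>
     stationary_distribution S K \<pi> \<and> reversible_wrt S K \<pi>"

definition heat_kernel ::
    "'a set \<Rightarrow> ('a \<Rightarrow> 'a \<Rightarrow> real) \<Rightarrow> real \<Rightarrow> 'a \<Rightarrow> 'a \<Rightarrow> real" where
  "heat_kernel S K t = kernel_exp S (\<lambda>x y. - t * (id_kernel x y - K x y))"

definition tv_dist_cont ::
    "'a set \<Rightarrow> ('a \<Rightarrow> 'a \<Rightarrow> real) \<Rightarrow> ('a \<Rightarrow> real) \<Rightarrow> real \<Rightarrow> real" where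
  "tv_dist_cont S K \<pi> t =
     (SUP (x, A) \<in> S \<times> Pow S. (\<Sum>y\<in>A. heat_kernel S K t x y) - (\<Sum>y\<in>A. \<pi> y))"

text \<open>
  \<open>d n\<close> is the distance function of the \<open>n\<close>-th chain of a family, and \<open>\<xi>\<close> enumerates the
  indices of a subfamily.
\<close>

definition has_tv_cutoff :: "(nat \<Rightarrow> real \<Rightarrow> real) \<Rightarrow> (nat \<Rightarrow> nat) \<Rightarrow> bool" where
  "has_tv_cutoff d \<xi> \<longleftrightarrow>
     (\<exists>t. (\<forall>k. 0 < t k) \<and>
          (\<forall>\<alpha>>1. (\<lambda>k. d (\<xi> k) (\<alpha> * t k)) \<longlonglongrightarrow> 0) \<and>
          (\<forall>\<alpha>\<in>{0<..<1}. (\<lambda>k. d (\<xi> k) (\<alpha> * t k)) \<longlonglongrightarrow> 1))"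

definition product_space :: "nat \<Rightarrow> (nat \<Rightarrow> 'a set) \<Rightarrow> (nat \<Rightarrow> 'a) set" where
  "product_space n X = PiE {1..n} X"

definition tensor_kernel ::
    "nat \<Rightarrow> (nat \<Rightarrow> 'a \<Rightarrow> 'a \<Rightarrow> real) \<Rightarrow> (nat \<Rightarrow> 'a) \<Rightarrow> (nat \<Rightarrow> 'a) \<Rightarrow> real" where
  "tensor_kernel n M x y = (\<Prod>j=1..n. M j (x j) (y j))"

definition product_kernel ::
    "nat \<Rightarrow> (nat \<Rightarrow> real) \<Rightarrow> (nat \<Rightarrow> 'a \<Rightarrow> 'a \<Rightarrow> real) \<Rightarrow>
     (nat \<Rightarrow> 'a) \<Rightarrow> (nat \<Rightarrow> 'a) \<Rightarrow> real" where
  "product_kernel n w K x y = (\<Sum>i=1..n. w i * tensor_kernel n ((\<lambda>_. id_kernel)(i := K i)) x y)"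

definition product_dist :: "nat \<Rightarrow> (nat \<Rightarrow> 'a \<Rightarrow> real) \<Rightarrow> (nat \<Rightarrow> 'a) \<Rightarrow> real" where
  "product_dist n \<pi> x = (\<Prod>i=1..n. \<pi> i (x i))"

text \<open>
  For \<open>n \<ge> 2\<close> the conditions below are pairwise disjoint on \<open>{0..2 * n}\<close>, so their order is
  immaterial.
\<close>

definition param_kernel :: "nat \<Rightarrow> real \<Rightarrow> real \<Rightarrow> real \<Rightarrow> nat \<Rightarrow> nat \<Rightarrow> real" where
  "param_kernel n a b c j k =
     (if j = n \<and> k = n + 1 then b
      else if j = n \<and> k = 2 * n then 1 - a - b
      else if j = 2 * n \<and> k = n then c
      else if j = 2 * n \<and> k = 2 * n then 1 - a - c
      else if j = 0 \<and> k = 0 then a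
      else if j \<noteq> 0 \<and> k = j - 1 then a
      else if j \<notin> {n, 2 * n} \<and> k = j + 1 then 1 - a
      else 0)"

lemma stationary_kernel_pow:
  assumes "finite S" "stationary_distribution S K \<pi>" "y \<in> S"
  shows "(\<Sum>x\<in>S. \<pi> x * kernel_pow S K m x y) = \<pi> y"
  using assms(3)
proof (induction m arbitrary: y)
  case 0
  then show ?case
    using assms(1) by (simp add: id_kernel_def if_distrib sum.delta' cong: if_cong)
next
  case (Suc m)
  have "(\<Sum>x\<in>S. \<pi> x * kernel_pow S K (Suc m) x y)
      = (\<Sum>x\<in>S. \<Sum>z\<in>S. \<pi> x * kernel_pow S K m x z * K z y)"
    by (simp add: kernel_mult_def sum_distrib_left mult.assoc)
  also have "\<dots> = (\<Sum>z\<in>S. (\<Sum>x\<in>S. \<pi> x * kernel_pow S K m x z) * K z y)"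
    by (subst sum.swap) (simp add: sum_distrib_right)
  also have "\<dots> = (\<Sum>z\<in>S. \<pi> z * K z y)"
    by (intro sum.cong refl) (simp add: Suc.IH)
  also have "\<dots> = \<pi> y"
    using assms(2) Suc.prems by (simp add: stationary_distribution_def)
  finally show ?case .
qed

lemma kernel_pow_nonneg:
  assumes "stochastic_kernel S K" "x \<in> S" "y \<in> S"
  shows "0 \<le> kernel_pow S K m x y"
  using assms(3)
proof (induction m arbitrary: y)
  case 0
  then show ?case by (simp add: id_kernel_def)
next
  case (Suc m)
  then show ?case
    using assms(1) by (auto simp: kernel_mult_def stochastic_kernel_def intro!: sum_nonneg)
qed

lemma stationary_pos:
  assumes "irreducible_reversible_chain S K \<pi>" "y \<in> S"
  shows "0 < \<pi> y"
proof -
  from assms have S: "finite S" "stochastic_kernel S K" "irreducible_kernel S K"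
      "stationary_distribution S K \<pi>"
    by (auto simp: irreducible_reversible_chain_def)
  have nn: "0 \<le> \<pi> x" if "x \<in> S" for x
    using S(4) that by (simp add: stationary_distribution_def)
  have "\<exists>x\<in>S. \<pi> x \<noteq> 0"
    using S(4) unfolding stationary_distribution_def by (metis sum.neutral zero_neq_one)
  then obtain x where x: "x \<in> S" "0 < \<pi> x"
    using nn by force
  then obtain m where m: "kernel_pow S K m x y > 0"
    using S(3) assms(2) by (auto simp: irreducible_kernel_def)
  have "0 < \<pi> x * kernel_pow S K m x y"
    using x m by simp
  also have "\<dots> \<le> (\<Sum>x\<in>S. \<pi> x * kernel_pow S K m x y)"
    by (rule member_le_sum)
       (use x S nn kernel_pow_nonneg[OF S(2) _ assms(2)] in auto)
  also have "\<dots> = \<pi> y"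
    by (rule stationary_kernel_pow) (use S assms(2) in auto)
  finally show ?thesis .
qed

text \<open>Detailed balance for this chain yields the expected relation between its parameters.\<close>

lemma param_kernel_relation:
  assumes n: "2 \<le> n"
    and chain: "irreducible_reversible_chain {0..2 * n} (param_kernel n a b c) \<pi>"
  shows "b * c * (1 - a) ^ (n - 1) = (1 - a - b) * a ^ n"
proof -
  have db: "\<pi> x * param_kernel n a b c x y = \<pi> y * param_kernel n a b c y x"
    if "x \<le> 2 * n" "y \<le> 2 * n" for x y
    using chain that by (auto simp: irreducible_reversible_chain_def reversible_wrt_def)
  have up: "\<pi> (n + 1) * (1 - a) ^ k = \<pi> (n + 1 + k) * a ^ k" if "k \<le> n - 1" for k
    using that
  proof (induction k)
    case (Suc k)
    have "\<pi> (n + 1 + k) * (1 - a) = \<pi> (n + 1 + Suc k) * a"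
      using db[of "n + 1 + k" "n + 1 + Suc k"] Suc.prems n
      by (simp add: param_kernel_def)
    with Suc show ?case
      by (simp add: mult.commute mult.left_commute)
  qed simp
  have "n + 1 + (n - 1) = 2 * n" using n by simp
  then have 1: "\<pi> (n + 1) * (1 - a) ^ (n - 1) = \<pi> (2 * n) * a ^ (n - 1)"
    using up[OF order.refl] by (simp only:)
  have 2: "\<pi> n * b = \<pi> (n + 1) * a"
    using db[of n "n + 1"] n by (simp add: param_kernel_def)
  have 3: "\<pi> n * (1 - a - b) = \<pi> (2 * n) * c"
    using db[of n "2 * n"] n by (simp add: param_kernel_def)
  have pow: "a ^ n = a * a ^ (n - 1)"
    using n by (cases n) auto
  have "\<pi> n * (b * c * (1 - a) ^ (n - 1)) = (\<pi> n * b) * (1 - a) ^ (n - 1) * c"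
    by simp
  also have "\<dots> = (\<pi> (n + 1) * (1 - a) ^ (n - 1)) * a * c"
    unfolding 2 by simp
  also have "\<dots> = (\<pi> (2 * n) * c) * a ^ n"
    unfolding 1 pow by simp
  also have "\<dots> = \<pi> n * ((1 - a - b) * a ^ n)"
    unfolding 3[symmetric] by simp
  finally show ?thesis
    using stationary_pos[OF chain, of n] by simp
qed

definition p_min :: "(nat \<Rightarrow> nat \<Rightarrow> real) \<Rightarrow> nat \<Rightarrow> real" where
  "p_min p n = Min (p n ` {1..n})"

definition E_set :: "(nat \<Rightarrow> nat \<Rightarrow> real) \<Rightarrow> nat \<Rightarrow> real \<Rightarrow> nat set" where
  "E_set p n \<delta> = {i \<in> {1..n}. p n i < (1 + \<delta>) * p_min p n}"

definition B_sum ::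
    "(nat \<Rightarrow> nat \<Rightarrow> real) \<Rightarrow> (nat \<Rightarrow> nat \<Rightarrow> real) \<Rightarrow> nat \<Rightarrow> real \<Rightarrow> real" where
  "B_sum p b n \<delta> = (\<Sum>i\<in>E_set p n \<delta>. b n i)"

definition F_upper ::
    "(nat \<Rightarrow> nat \<Rightarrow> real) \<Rightarrow> (nat \<Rightarrow> nat \<Rightarrow> real) \<Rightarrow> (nat \<Rightarrow> nat) \<Rightarrow> real \<Rightarrow> ereal" where
  "F_upper p b \<xi> \<delta> = limsup (\<lambda>k. ereal (B_sum p b (\<xi> k) \<delta>))"

definition F_lower ::
    "(nat \<Rightarrow> nat \<Rightarrow> real) \<Rightarrow> (nat \<Rightarrow> nat \<Rightarrow> real) \<Rightarrow> (nat \<Rightarrow> nat) \<Rightarrow> real \<Rightarrow> ereal" where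
  "F_lower p b \<xi> \<delta> = liminf (\<lambda>k. ereal (B_sum p b (\<xi> k) \<delta>))"

text \<open>
  The explicit case distinctions implement the conventions \<open>sup \<emptyset> = 0\<close> and \<open>inf \<emptyset> = 1\<close>.
\<close>

definition Delta_zero :: "(real \<Rightarrow> ereal) \<Rightarrow> real" where
  "Delta_zero F =
     (let D = {\<delta> \<in> {0<..<1}. F \<delta> = 0} in if D = {} then 0 else Sup D)"

definition Delta_inf :: "(real \<Rightarrow> ereal) \<Rightarrow> real" where
  "Delta_inf F =
     (let D = {\<delta> \<in> {0<..<1}. F \<delta> = \<infinity>} in if D = {} then 1 else Inf D)"

definition Delta_zero_upper ::
    "(nat \<Rightarrow> nat \<Rightarrow> real) \<Rightarrow> (nat \<Rightarrow> nat \<Rightarrow> real) \<Rightarrow> (nat \<Rightarrow> nat) \<Rightarrow> real" where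
  "Delta_zero_upper p b \<xi> = Delta_zero (F_upper p b \<xi>)"

definition Delta_zero_lower ::
    "(nat \<Rightarrow> nat \<Rightarrow> real) \<Rightarrow> (nat \<Rightarrow> nat \<Rightarrow> real) \<Rightarrow> (nat \<Rightarrow> nat) \<Rightarrow> real" where
  "Delta_zero_lower p b \<xi> = Delta_zero (F_lower p b \<xi>)"

definition Delta_inf_upper ::
    "(nat \<Rightarrow> nat \<Rightarrow> real) \<Rightarrow> (nat \<Rightarrow> nat \<Rightarrow> real) \<Rightarrow> (nat \<Rightarrow> nat) \<Rightarrow> real" where
  "Delta_inf_upper p b \<xi> = Delta_inf (F_upper p b \<xi>)"

definition Delta_inf_lower ::
    "(nat \<Rightarrow> nat \<Rightarrow> real) \<Rightarrow> (nat \<Rightarrow> nat \<Rightarrow> real) \<Rightarrow> (nat \<Rightarrow> nat) \<Rightarrow> real" where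
  "Delta_inf_lower p b \<xi> = Delta_inf (F_lower p b \<xi>)"

text \<open>
  The distance function of the continuous time \<open>n\<close>-th product chain, with weights
  \<open>p n i / (p n 1 + \<dots> + p n n)\<close>.
\<close>

definition product_tv ::
    "(nat \<Rightarrow> nat \<Rightarrow> real) \<Rightarrow> (nat \<Rightarrow> nat \<Rightarrow> real) \<Rightarrow> (nat \<Rightarrow> nat \<Rightarrow> real) \<Rightarrow>
     (nat \<Rightarrow> nat \<Rightarrow> real) \<Rightarrow> (nat \<Rightarrow> nat \<Rightarrow> nat \<Rightarrow> real) \<Rightarrow> nat \<Rightarrow> real \<Rightarrow> real" where
  "product_tv p a b c \<pi> n =
     tv_dist_cont
       (product_space n (\<lambda>i. {0..2 * n}))
       (product_kernel n (\<lambda>i. p n i / (\<Sum>j=1..n. p n j))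
          (\<lambda>i. param_kernel n (a n i) (b n i) (c n i)))
       (product_dist n (\<pi> n))"

end

theory Submission
  imports Defs
begin

text \<open>
  One coordinate, started at \<open>0\<close>, climbs to \<open>n\<close> in about \<open>n\<close> steps.  From there it jumps to \<open>2 * n\<close>, where nearly all
  of the stationary mass sits; but with probability \<open>b\<close> it makes a detour through \<open>n + 1, \<dots>, 2 * n - 1\<close> and
  arrives only after about \<open>2 * n\<close> steps.  In the continuous time product chain the coordinates are independent
  (\<open>heat_kernel_product\<close>), and the \<open>i\<close>-th one moves at rate \<open>p\<^sub>i / q\<close>.  Let \<open>\<tau> = n q / \<^bold>p\<close>, with \<open>\<^bold>p\<close> the least of the
  \<open>p\<^sub>i\<close>, be the time in which the slowest coordinate makes \<open>n\<close> steps on average.  At time \<open>s \<tau>\<close> with \<open>1 < s < 2\<close> every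
  coordinate has had enough time for the direct way, and exactly the coordinates with \<open>s * p\<^sub>i < 2 \<^bold>p\<close>, those in
  \<open>E\<^sub>\<delta>\<close> for \<open>\<delta> = 2 / s - 1\<close>, have not had enough time for the detour.  So the distance to stationarity at that time is
  about the probability that one of these makes the detour, that is, roughly \<open>1 - exp (- B\<^sub>\<delta>)\<close>; before \<open>\<tau>\<close> it is
  close to \<open>1\<close>, after \<open>2 \<tau>\<close> close to \<open>0\<close>.

  These statements hold up to constants in the exponent and an arbitrarily small change of \<open>\<delta>\<close>
  (\<open>d_before\<close>, \<open>d_upper_bound\<close>, \<open>d_lower_bound\<close>), which is all that matters for limits \<open>0\<close> and \<open>1\<close>.  Their proofs
  compare the law of the chain with \<open>\<pi>\<close> only at the single state \<open>z\<close> with all coordinates equal to \<open>2 * n\<close>: the distance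
  is at most \<open>1 - min\<^sub>x H\<^sub>t(x,z)\<close> and at least \<open>\<pi>(z) - H\<^sub>t(0,z)\<close>, and both heat kernels factorize.  Errors have to
  be summed over \<open>n\<close> coordinates.  Wrong moves contribute \<open>n * \<Sum>a\<^sub>i\<close>, which tends to \<open>0\<close> by hypothesis,
  and fluctuations of the number of steps contribute Poisson tails that decay exponentially in \<open>n\<close>.

  It follows that some subsequence of a given sequence of indices has a cutoff precisely if along some subsequence
  there is a \<open>D\<close> such that \<open>B\<^sub>\<delta>\<close> tends to \<open>0\<close> for \<open>\<delta> < D\<close> and to infinity for \<open>\<delta> > D\<close>; the cutoff time is then
  \<open>2 / (1 + D) * \<tau>\<close> (\<open>cutoff_if_threshold\<close>, \<open>threshold_if_cutoff\<close>).  Along such a sequence neither pair of critical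
  values is separated (\<open>Delta_not_less_if_threshold\<close>).  Conversely, if for some sequence one of the pairs is not separated,
  a diagonal subsequence has this property (\<open>threshold_if_upper_not_less\<close>, \<open>threshold_if_lower_not_less\<close>).
  So each of the three conditions fails precisely if some sequence of indices has such a threshold \<open>D\<close>.
\<close>

section \<open>Exponentials of kernels\<close>

lemma id_kernel_apply:
  assumes "finite S" "x \<in> S"
  shows "(\<Sum>z\<in>S. id_kernel x z * f z) = f x"
  using assms by (simp add: id_kernel_def if_distrib[of "\<lambda>c. c * _"] sum.delta cong: if_cong)

lemma id_kernel_apply':
  assumes "finite S" "x \<in> S"
  shows "(\<Sum>z\<in>S. f z * id_kernel z x) = f x"
  using assms by (simp add: id_kernel_def if_distrib sum.delta' cong: if_cong)

lemma kernel_pow_scale: "kernel_pow S (\<lambda>x y. t * A x y) m x y = t ^ m * kernel_pow S A m x y"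
proof (induction m arbitrary: y)
  case (Suc m)
  then show ?case
    by (auto simp: kernel_mult_def sum_distrib_left mult_ac intro!: sum.cong)
qed simp

lemma kernel_pow_Suc_left:
  assumes "finite S" "x \<in> S" "y \<in> S"
  shows "kernel_pow S A (Suc m) x y = (\<Sum>z\<in>S. A x z * kernel_pow S A m z y)"
  using assms(3)
proof (induction m arbitrary: y)
  case 0
  then show ?case
    using assms by (simp add: kernel_mult_def id_kernel_apply id_kernel_apply')
next
  case (Suc m)
  have "kernel_pow S A (Suc (Suc m)) x y = (\<Sum>w\<in>S. kernel_pow S A (Suc m) x w * A w y)"
    by (simp add: kernel_mult_def)
  also have "\<dots> = (\<Sum>w\<in>S. \<Sum>z\<in>S. A x z * kernel_pow S A m z w * A w y)"
    by (intro sum.cong refl) (simp only: Suc.IH sum_distrib_right)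
  also have "\<dots> = (\<Sum>z\<in>S. \<Sum>w\<in>S. A x z * kernel_pow S A m z w * A w y)"
    by (rule sum.swap)
  also have "\<dots> = (\<Sum>z\<in>S. A x z * kernel_pow S A (Suc m) z y)"
    by (simp add: kernel_mult_def sum_distrib_left mult.assoc)
  finally show ?case .
qed

lemma kernel_pow_abs_le:
  assumes "finite S" "\<And>x y. x \<in> S \<Longrightarrow> y \<in> S \<Longrightarrow> \<bar>A x y\<bar> \<le> C" "0 \<le> C" "x \<in> S" "y \<in> S"
  shows "\<bar>kernel_pow S A m x y\<bar> \<le> (real (card S) * C) ^ m"
  using assms(5)
proof (induction m arbitrary: y)
  case 0
  then show ?case by (simp add: id_kernel_def)
next
  case (Suc m)
  have "\<bar>kernel_pow S A (Suc m) x y\<bar> \<le> (\<Sum>z\<in>S. \<bar>kernel_pow S A m x z * A z y\<bar>)"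
    by (simp add: kernel_mult_def sum_abs)
  also have "\<dots> \<le> (\<Sum>z\<in>S. (real (card S) * C) ^ m * C)"
    unfolding abs_mult using assms Suc by (intro sum_mono mult_mono) auto
  finally show ?case by (simp add: mult_ac)
qed

lemma kernel_pow_summable:
  assumes "finite S" "x \<in> S" "y \<in> S"
  shows "summable (\<lambda>m. kernel_pow S A m x y / fact m * t ^ m)"
proof -
  define C where "C = (\<Sum>x\<in>S. \<Sum>y\<in>S. \<bar>A x y\<bar>)"
  have C: "\<bar>A x y\<bar> \<le> C" if "x \<in> S" "y \<in> S" for x y
  proof -
    have "\<bar>A x y\<bar> \<le> (\<Sum>y\<in>S. \<bar>A x y\<bar>)"
      by (rule member_le_sum) (use that assms in auto)
    also have "\<dots> \<le> C"
      unfolding C_def by (rule member_le_sum) (use that assms in \<open>auto intro: sum_nonneg\<close>)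
    finally show ?thesis .
  qed
  have C0: "0 \<le> C" by (simp add: C_def sum_nonneg)
  have "summable (\<lambda>m. inverse (fact m) * (real (card S) * C * \<bar>t\<bar>) ^ m)"
    by (rule summable_exp)
  then show ?thesis
  proof (rule summable_comparison_test'[where N = 0])
    fix m :: nat
    have "\<bar>kernel_pow S A m x y\<bar> * \<bar>t\<bar> ^ m \<le> (real (card S) * C) ^ m * \<bar>t\<bar> ^ m"
      by (intro mult_right_mono kernel_pow_abs_le) (use assms C C0 in auto)
    then show "norm (kernel_pow S A m x y / fact m * t ^ m)
        \<le> inverse (fact m) * (real (card S) * C * \<bar>t\<bar>) ^ m"
      by (simp add: abs_mult power_abs power_mult_distrib divide_simps mult_ac)
  qed
qed

lemma kernel_exp_scaled:
  "kernel_exp S (\<lambda>x y. t * A x y) x y = (\<Sum>m. kernel_pow S A m x y / fact m * t ^ m)"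
  unfolding kernel_exp_def by (simp add: kernel_pow_scale mult.commute)

lemma kernel_exp_at_0: "kernel_exp S (\<lambda>x y. 0 * A x y) x y = id_kernel x y"
  by (subst kernel_exp_scaled) (simp_all only: powser_zero, simp)

lemma kernel_exp_deriv_aux:
  assumes "finite S" "x \<in> S" "y \<in> S"
  shows "((\<lambda>t. kernel_exp S (\<lambda>x y. t * A x y) x y) has_real_derivative
            (\<Sum>m. kernel_pow S A (Suc m) x y / fact m * t ^ m)) (at t)"
proof -
  have eq: "diffs (\<lambda>m. kernel_pow S A m x y / fact m) = (\<lambda>m. kernel_pow S A (Suc m) x y / fact m)"
    by (rule ext) (simp add: diffs_def fact_Suc divide_simps)
  have "((\<lambda>t. \<Sum>m. kernel_pow S A m x y / fact m * t ^ m) has_real_derivative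
            (\<Sum>m. diffs (\<lambda>m. kernel_pow S A m x y / fact m) m * t ^ m)) (at t)"
    by (rule termdiffs_strong_converges_everywhere) (rule kernel_pow_summable[OF assms])
  then show ?thesis
    unfolding eq using assms by (simp add: kernel_exp_scaled)
qed

text \<open>
  Splitting off the first or the last factor of \<open>A\<^sup>m\<^sup>+\<^sup>1\<close> gives the two forms \<open>A e\<^sup>t\<^sup>A\<close> and \<open>e\<^sup>t\<^sup>A A\<close> of the derivative
  (the backward and the forward equation).  The uniqueness argument below plays one against the other.
\<close>

lemma kernel_exp_deriv_left:
  assumes "finite S" "x \<in> S" "y \<in> S"
  shows "((\<lambda>t. kernel_exp S (\<lambda>x y. t * A x y) x y) has_real_derivative
            (\<Sum>z\<in>S. A x z * kernel_exp S (\<lambda>x y. t * A x y) z y)) (at t)"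
proof -
  have "(\<Sum>m. kernel_pow S A (Suc m) x y / fact m * t ^ m)
      = (\<Sum>m. \<Sum>z\<in>S. A x z * (kernel_pow S A m z y / fact m * t ^ m))"
    using assms by (simp only: kernel_pow_Suc_left sum_divide_distrib sum_distrib_right) (simp add: mult_ac)
  also have "\<dots> = (\<Sum>z\<in>S. \<Sum>m. A x z * (kernel_pow S A m z y / fact m * t ^ m))"
    by (intro suminf_sum summable_mult kernel_pow_summable assms)
  also have "\<dots> = (\<Sum>z\<in>S. A x z * kernel_exp S (\<lambda>x y. t * A x y) z y)"
    by (intro sum.cong refl)
      (use assms in \<open>simp only: kernel_exp_scaled suminf_mult[OF kernel_pow_summable]\<close>)
  finally show ?thesis
    using kernel_exp_deriv_aux[OF assms, of A t] by simp
qed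

lemma kernel_exp_deriv_right:
  assumes "finite S" "x \<in> S" "y \<in> S"
  shows "((\<lambda>t. kernel_exp S (\<lambda>x y. t * A x y) x y) has_real_derivative
            (\<Sum>z\<in>S. kernel_exp S (\<lambda>x y. t * A x y) x z * A z y)) (at t)"
proof -
  have "(\<Sum>m. kernel_pow S A (Suc m) x y / fact m * t ^ m)
      = (\<Sum>m. \<Sum>z\<in>S. A z y * (kernel_pow S A m x z / fact m * t ^ m))"
    by (simp add: kernel_mult_def sum_divide_distrib sum_distrib_left mult_ac)
  also have "\<dots> = (\<Sum>z\<in>S. \<Sum>m. A z y * (kernel_pow S A m x z / fact m * t ^ m))"
    by (intro suminf_sum summable_mult kernel_pow_summable assms)
  also have "\<dots> = (\<Sum>z\<in>S. A z y * kernel_exp S (\<lambda>x y. t * A x y) x z)"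
    by (intro sum.cong refl)
      (use assms in \<open>simp only: kernel_exp_scaled suminf_mult[OF kernel_pow_summable]\<close>)
  finally show ?thesis
    using kernel_exp_deriv_aux[OF assms, of A t] by (simp add: mult.commute)
qed

text \<open>
  Solutions of the linear system \<open>F' = A F\<close> are unique: for fixed \<open>T\<close>, the function
  \<open>s \<mapsto> e\<^sup>s\<^sup>A F(T - s)\<close> has derivative zero, so its values at \<open>0\<close> and \<open>T\<close> agree.
  The semigroup law, conservation of mass, the expansion over Poisson many steps and the factorization over
  the coordinates of a product chain are all obtained by checking this equation for a candidate \<open>F\<close>.
\<close>

lemma kernel_exp_unique:
  assumes fin: "finite S" and x: "x \<in> S"
    and F: "\<And>t x. x \<in> S \<Longrightarrow> ((\<lambda>t. F t x) has_real_derivative (\<Sum>z\<in>S. A x z * F t z)) (at t)"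
  shows "F T x = (\<Sum>z\<in>S. kernel_exp S (\<lambda>x y. T * A x y) x z * F 0 z)"
proof -
  define G where "G = (\<lambda>s. kernel_exp S (\<lambda>x y. s * A x y) x)"
  define \<phi> where "\<phi> s = (\<Sum>z\<in>S. G s z * F (T - s) z)" for s
  have "(\<phi> has_real_derivative 0) (at s)" for s
  proof -
    have dF: "((\<lambda>s. F (T - s) z) has_real_derivative - (\<Sum>w\<in>S. A z w * F (T - s) w)) (at s)"
      if "z \<in> S" for z
    proof -
      have "((\<lambda>s. F (T - s) z) has_real_derivative (\<Sum>w\<in>S. A z w * F (T - s) w) * (- 1)) (at s)"
        by (rule DERIV_chain'[where f = "\<lambda>s. T - s", OF _ F[OF that]])
          (auto intro!: derivative_eq_intros)
      then show ?thesis by simp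
    qed
    have dG: "((\<lambda>s. G s z) has_real_derivative (\<Sum>w\<in>S. G s w * A w z)) (at s)" if "z \<in> S" for z
      unfolding G_def by (rule kernel_exp_deriv_right[OF fin x that])
    have "(\<phi> has_real_derivative (\<Sum>z\<in>S. G s z * - (\<Sum>w\<in>S. A z w * F (T - s) w)
             + (\<Sum>w\<in>S. G s w * A w z) * F (T - s) z)) (at s)"
      unfolding \<phi>_def by (intro DERIV_sum DERIV_mult' dF dG)
    moreover have "(\<Sum>z\<in>S. (\<Sum>w\<in>S. G s w * A w z) * F (T - s) z)
        = (\<Sum>z\<in>S. G s z * (\<Sum>w\<in>S. A z w * F (T - s) w))"
      unfolding sum_distrib_left sum_distrib_right
      by (subst sum.swap) (simp add: mult.assoc)
    ultimately show ?thesis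
      by (simp add: sum.distrib sum_negf sum_subtractf)
  qed
  then have "\<phi> T = \<phi> 0"
    using DERIV_isconst_all[of \<phi> T 0] by blast
  moreover have "\<phi> 0 = F T x"
  proof -
    have "\<phi> 0 = (\<Sum>z\<in>S. id_kernel x z * F T z)"
      unfolding \<phi>_def G_def using fin x by (intro sum.cong refl) (simp only: kernel_exp_at_0 diff_0_right)
    then show ?thesis
      using fin x by (simp add: id_kernel_apply)
  qed
  ultimately show ?thesis
    by (simp add: \<phi>_def G_def)
qed

section \<open>Heat kernels\<close>

definition generator :: "('a \<Rightarrow> 'a \<Rightarrow> real) \<Rightarrow> 'a \<Rightarrow> 'a \<Rightarrow> real" where
  "generator K x y = K x y - id_kernel x y"

lemma heat_kernel_eq: "heat_kernel S K t = kernel_exp S (\<lambda>x y. t * generator K x y)"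
  by (simp add: heat_kernel_def generator_def algebra_simps)

lemma generator_apply:
  assumes "finite S" "x \<in> S"
  shows "(\<Sum>z\<in>S. generator K x z * f z) = (\<Sum>z\<in>S. K x z * f z) - f x"
  using assms
  by (simp add: generator_def left_diff_distrib sum_subtractf id_kernel_apply)

lemma heat_kernel_0: "heat_kernel S K 0 x y = id_kernel x y"
  unfolding heat_kernel_eq by (rule kernel_exp_at_0)

lemma heat_kernel_unique:
  assumes fin: "finite S" and x: "x \<in> S"
    and F: "\<And>t x. x \<in> S \<Longrightarrow> ((\<lambda>t. F t x) has_real_derivative (\<Sum>z\<in>S. K x z * F t z) - F t x) (at t)"
  shows "F T x = (\<Sum>z\<in>S. heat_kernel S K T x z * F 0 z)"
  unfolding heat_kernel_eq
  by (rule kernel_exp_unique[OF fin x]) (use F fin in \<open>simp add: generator_apply\<close>)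

lemma heat_kernel_unique_id:
  assumes fin: "finite S" and x: "x \<in> S" and y: "y \<in> S"
    and F: "\<And>t x. x \<in> S \<Longrightarrow> ((\<lambda>t. F t x) has_real_derivative (\<Sum>z\<in>S. K x z * F t z) - F t x) (at t)"
    and F0: "\<And>x. x \<in> S \<Longrightarrow> F 0 x = id_kernel x y"
  shows "F T x = heat_kernel S K T x y"
proof -
  have "F T x = (\<Sum>z\<in>S. heat_kernel S K T x z * id_kernel z y)"
    using heat_kernel_unique[where F = F, OF fin x F] F0 by simp
  then show ?thesis
    using fin y by (simp add: id_kernel_apply')
qed

lemma heat_kernel_deriv:
  assumes "finite S" "x \<in> S" "y \<in> S"
  shows "((\<lambda>t. heat_kernel S K t x y) has_real_derivative
            (\<Sum>z\<in>S. K x z * heat_kernel S K t z y) - heat_kernel S K t x y) (at t)"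
  using kernel_exp_deriv_left[OF assms, of "generator K" t] assms(1,2)
  unfolding heat_kernel_eq by (simp add: generator_apply)

lemma heat_kernel_semigroup:
  assumes "finite S" "x \<in> S" "y \<in> S"
  shows "heat_kernel S K (s + t) x y = (\<Sum>z\<in>S. heat_kernel S K s x z * heat_kernel S K t z y)"
proof -
  have "((\<lambda>s. heat_kernel S K (s + t) x y) has_real_derivative
            (\<Sum>z\<in>S. K x z * heat_kernel S K (s + t) z y) - heat_kernel S K (s + t) x y) (at s)"
    if "x \<in> S" for s x
    using heat_kernel_deriv[OF assms(1) that assms(3), of K "s + t"] by (simp add: DERIV_shift)
  from heat_kernel_unique[where F = "\<lambda>s x. heat_kernel S K (s + t) x y", OF assms(1,2) this]
  show ?thesis by simp
qed

lemma heat_kernel_row_sum: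
  assumes "finite S" "stochastic_kernel S K" "x \<in> S"
  shows "(\<Sum>y\<in>S. heat_kernel S K t x y) = 1"
proof -
  have "((\<lambda>t. 1) has_real_derivative (\<Sum>z\<in>S. K x z * 1) - 1) (at t)" if "x \<in> S" for x and t :: real
    using assms(2) that by (auto simp: stochastic_kernel_def)
  from heat_kernel_unique[where F = "\<lambda>_ _. 1", OF assms(1,3) this]
  show ?thesis by simp
qed

definition poisson_weight :: "real \<Rightarrow> nat \<Rightarrow> real" where
  "poisson_weight u m = exp (- u) * u ^ m / fact m"

lemma poisson_weight_nonneg: "0 \<le> u \<Longrightarrow> 0 \<le> poisson_weight u m"
  by (simp add: poisson_weight_def)

text \<open>
  Since \<open>e\<^sup>-\<^sup>t\<^sup>(\<^sup>I\<^sup>-\<^sup>K\<^sup>) = e\<^sup>-\<^sup>t e\<^sup>t\<^sup>K\<close>, the continuous time chain makes the steps of the discrete chain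
  at the points of a Poisson process.
\<close>

lemma heat_kernel_poisson:
  assumes "finite S" "x \<in> S" "y \<in> S"
  shows "(\<lambda>m. poisson_weight t m * kernel_pow S K m x y) sums heat_kernel S K t x y"
proof -
  let ?E = "\<lambda>t x. kernel_exp S (\<lambda>x y. t * K x y) x y"
  have "exp (- t) * ?E t x = heat_kernel S K t x y"
  proof (rule heat_kernel_unique_id[where F = "\<lambda>t x. exp (- t) * ?E t x", OF assms], goal_cases)
    case (1 t x)
    have "((\<lambda>t. exp (- t) * ?E t x) has_real_derivative
        exp (- t) * (\<Sum>z\<in>S. K x z * ?E t z) + - exp (- t) * ?E t x) (at t)"
      by (rule DERIV_mult'[OF _ kernel_exp_deriv_left[OF assms(1) 1 assms(3)]])
         (auto intro!: derivative_eq_intros)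
    then show ?case
      by (simp add: sum_distrib_left mult_ac)
  next
    case (2 x)
    then show ?case
      using assms kernel_exp_at_0[of S K x y] by simp
  qed
  moreover have "(\<lambda>m. exp (- t) * (kernel_pow S K m x y / fact m * t ^ m)) sums (exp (- t) * ?E t x)"
    unfolding kernel_exp_scaled
    by (intro sums_mult summable_sums kernel_pow_summable assms)
  ultimately show ?thesis
    by (simp add: poisson_weight_def mult_ac)
qed

lemma poisson_weight_gf: "(\<lambda>m. poisson_weight u m * r ^ m) sums exp (u * (r - 1))"
proof -
  have "(\<lambda>m. exp (- u) * ((u * r) ^ m /\<^sub>R fact m)) sums (exp (- u) * exp (u * r))"
    by (intro sums_mult exp_converges)
  then show ?thesis
    by (simp add: poisson_weight_def power_mult_distrib divide_inverse mult_ac exp_add[symmetric]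
        algebra_simps)
qed

lemma poisson_weight_sums: "poisson_weight u sums 1"
  using poisson_weight_gf[of u 1] by simp

lemma poisson_weight_mean: "(\<lambda>m. poisson_weight u m * real m) sums u"
proof -
  have "(\<lambda>m. u * poisson_weight u m) sums (u * 1)"
    by (intro sums_mult poisson_weight_sums)
  moreover have "poisson_weight u (Suc m) * real (Suc m) = u * poisson_weight u m" for m
    by (simp add: poisson_weight_def fact_Suc divide_simps)
  ultimately have "(\<lambda>m. poisson_weight u (Suc m) * real (Suc m)) sums u"
    by simp
  then show ?thesis
    by (subst (asm) sums_Suc_iff) simp
qed

lemma heat_kernel_nonneg:
  assumes "finite S" "stochastic_kernel S K" "x \<in> S" "y \<in> S" "0 \<le> t"
  shows "0 \<le> heat_kernel S K t x y"
proof (rule sums_le[OF _ sums_zero heat_kernel_poisson])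
  show "0 \<le> poisson_weight t m * kernel_pow S K m x y" for m
    using assms by (simp add: poisson_weight_nonneg kernel_pow_nonneg)
qed (use assms in auto)

lemma heat_kernel_le_1:
  assumes "finite S" "stochastic_kernel S K" "x \<in> S" "y \<in> S" "0 \<le> t"
  shows "heat_kernel S K t x y \<le> 1"
proof -
  have "heat_kernel S K t x y \<le> (\<Sum>y\<in>S. heat_kernel S K t x y)"
    by (rule member_le_sum) (use assms heat_kernel_nonneg in auto)
  then show ?thesis using assms by (simp add: heat_kernel_row_sum)
qed

lemma heat_kernel_stationary:
  assumes "finite S" "stationary_distribution S K \<pi>" "y \<in> S"
  shows "(\<Sum>x\<in>S. \<pi> x * heat_kernel S K t x y) = \<pi> y"
proof -
  have "(\<lambda>m. \<Sum>x\<in>S. \<pi> x * (poisson_weight t m * kernel_pow S K m x y))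
          sums (\<Sum>x\<in>S. \<pi> x * heat_kernel S K t x y)"
    by (intro sums_sum sums_mult heat_kernel_poisson assms)
  moreover have "(\<Sum>x\<in>S. \<pi> x * (poisson_weight t m * kernel_pow S K m x y)) = poisson_weight t m * \<pi> y"
    for m
    unfolding stationary_kernel_pow[OF assms, of m, symmetric]
    by (simp add: sum_distrib_left mult.left_commute)
  moreover have "(\<lambda>m. poisson_weight t m * \<pi> y) sums (1 * \<pi> y)"
    by (intro sums_mult2 poisson_weight_sums)
  ultimately show ?thesis
    by (simp add: sums_unique2)
qed

text \<open>
  Condition on the state at time \<open>t - s\<close>: wherever the chain is, during the remaining time \<open>s\<close> it moves to \<open>y\<close>
  with probability at least \<open>h\<close>.  So it suffices to bound the worst-case probability of being at \<open>y\<close> at a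
  single early time, even for coordinates that run much faster.
\<close>

lemma heat_kernel_ge_later:
  assumes "finite S" "stochastic_kernel S K" "x \<in> S" "y \<in> S" "0 \<le> s" "s \<le> t"
    and h: "\<And>x. x \<in> S \<Longrightarrow> h \<le> heat_kernel S K s x y"
  shows "h \<le> heat_kernel S K t x y"
proof -
  have "h = (\<Sum>z\<in>S. heat_kernel S K (t - s) x z * h)"
    using assms by (simp add: sum_distrib_right[symmetric] heat_kernel_row_sum)
  also have "\<dots> \<le> (\<Sum>z\<in>S. heat_kernel S K (t - s) x z * heat_kernel S K s z y)"
    by (intro sum_mono mult_left_mono h heat_kernel_nonneg) (use assms in auto)
  also have "\<dots> = heat_kernel S K t x y"
    using heat_kernel_semigroup[OF assms(1,3,4), of K "t - s" s] by simp
  finally show ?thesis .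
qed

section \<open>Total variation distance\<close>

lemma tv_dist_cont_ge:
  assumes "finite S" "x \<in> S" "A \<subseteq> S"
  shows "(\<Sum>y\<in>A. heat_kernel S K t x y) - (\<Sum>y\<in>A. \<pi> y) \<le> tv_dist_cont S K \<pi> t"
  unfolding tv_dist_cont_def
  by (rule cSUP_upper2[where x = "(x, A)"]) (use assms in \<open>auto intro!: bdd_above_finite\<close>)

lemma tv_dist_cont_le:
  assumes "S \<noteq> {}"
    and "\<And>x A. x \<in> S \<Longrightarrow> A \<subseteq> S \<Longrightarrow> (\<Sum>y\<in>A. heat_kernel S K t x y) - (\<Sum>y\<in>A. \<pi> y) \<le> D"
  shows "tv_dist_cont S K \<pi> t \<le> D"
  unfolding tv_dist_cont_def
  by (rule cSUP_least) (use assms in auto)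

lemma tv_dist_cont_nonneg:
  assumes "finite S" "S \<noteq> {}"
  shows "0 \<le> tv_dist_cont S K \<pi> t"
  using assms tv_dist_cont_ge[of S _ "{}" K t \<pi>] by auto

lemma tv_dist_cont_antimono:
  assumes "finite S" "S \<noteq> {}" "stochastic_kernel S K" "0 \<le> s" "s \<le> t"
  shows "tv_dist_cont S K \<pi> t \<le> tv_dist_cont S K \<pi> s"
proof (rule tv_dist_cont_le[OF assms(2)])
  fix x A assume x: "x \<in> S" and A: "A \<subseteq> S"
  let ?H = "heat_kernel S K"
  have "(\<Sum>y\<in>A. ?H t x y) = (\<Sum>y\<in>A. \<Sum>z\<in>S. ?H (t - s) x z * ?H s z y)"
    using A x assms(1) heat_kernel_semigroup[of S x _ K "t - s" s] by (intro sum.cong) auto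
  also have "\<dots> = (\<Sum>z\<in>S. ?H (t - s) x z * (\<Sum>y\<in>A. ?H s z y))"
    by (subst sum.swap) (simp add: sum_distrib_left)
  also have "\<dots> \<le> (\<Sum>z\<in>S. ?H (t - s) x z * (tv_dist_cont S K \<pi> s + (\<Sum>y\<in>A. \<pi> y)))"
  proof (intro sum_mono mult_left_mono)
    fix z assume "z \<in> S"
    then show "(\<Sum>y\<in>A. ?H s z y) \<le> tv_dist_cont S K \<pi> s + (\<Sum>y\<in>A. \<pi> y)"
      using tv_dist_cont_ge[OF assms(1) _ A, of z K s \<pi>] by simp
    show "0 \<le> ?H (t - s) x z"
      using assms x \<open>z \<in> S\<close> by (intro heat_kernel_nonneg) auto
  qed
  also have "\<dots> = tv_dist_cont S K \<pi> s + (\<Sum>y\<in>A. \<pi> y)"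
    using assms x by (simp add: sum_distrib_right[symmetric] heat_kernel_row_sum)
  finally show "(\<Sum>y\<in>A. ?H t x y) - (\<Sum>y\<in>A. \<pi> y) \<le> tv_dist_cont S K \<pi> s" by simp
qed

lemma stationary_ge_heat_kernel:
  assumes "finite S" "stationary_distribution S K \<pi>" "z \<in> S"
    and h: "\<And>x. x \<in> S \<Longrightarrow> h \<le> heat_kernel S K t x z"
  shows "h \<le> \<pi> z"
proof -
  have "h = (\<Sum>x\<in>S. \<pi> x * h)"
    using assms(2) by (simp add: sum_distrib_right[symmetric] stationary_distribution_def)
  also have "\<dots> \<le> (\<Sum>x\<in>S. \<pi> x * heat_kernel S K t x z)"
    using assms(2) by (intro sum_mono mult_left_mono h) (auto simp: stationary_distribution_def)
  finally show ?thesis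
    using heat_kernel_stationary[OF assms(1,2,3), of t] by simp
qed

text \<open>
  Both \<open>H\<^sub>t(x,\<cdot>)\<close> and, by stationarity, \<open>\<pi>\<close> give mass at least \<open>h\<close> to \<open>z\<close>.  So \<open>H\<^sub>t(x,A) \<le> 1 - h\<close> if
  \<open>z \<notin> A\<close>, and \<open>\<pi>(A) \<ge> h\<close> if \<open>z \<in> A\<close>.
\<close>

lemma tv_dist_cont_le_one_minus:
  assumes "finite S" "stochastic_kernel S K" "stationary_distribution S K \<pi>" "z \<in> S" "0 \<le> t"
    and h: "\<And>x. x \<in> S \<Longrightarrow> h \<le> heat_kernel S K t x z"
  shows "tv_dist_cont S K \<pi> t \<le> 1 - h"
proof (rule tv_dist_cont_le)
  fix x A assume x: "x \<in> S" and A: "A \<subseteq> S"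
  have pos: "0 \<le> heat_kernel S K t x y" "0 \<le> \<pi> y" if "y \<in> S" for y
    using assms x that by (auto intro!: heat_kernel_nonneg simp: stationary_distribution_def)
  have "finite A" using A assms(1) by (rule finite_subset)
  have total: "(\<Sum>y\<in>S. heat_kernel S K t x y) = 1"
    by (rule heat_kernel_row_sum) (use assms x in auto)
  show "(\<Sum>y\<in>A. heat_kernel S K t x y) - (\<Sum>y\<in>A. \<pi> y) \<le> 1 - h"
  proof (cases "z \<in> A")
    case True
    have "(\<Sum>y\<in>A. heat_kernel S K t x y) \<le> 1"
      unfolding total[symmetric] by (rule sum_mono2) (use assms A pos in auto)
    moreover have "\<pi> z \<le> (\<Sum>y\<in>A. \<pi> y)"
      by (rule member_le_sum) (use True A pos \<open>finite A\<close> in auto)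
    moreover have "h \<le> \<pi> z"
      by (rule stationary_ge_heat_kernel[where t = t]) (use assms in auto)
    ultimately show ?thesis by simp
  next
    case False
    have "(\<Sum>y\<in>A. heat_kernel S K t x y) \<le> (\<Sum>y\<in>S - {z}. heat_kernel S K t x y)"
      by (rule sum_mono2) (use assms A pos False in auto)
    also have "\<dots> = 1 - heat_kernel S K t x z"
      using assms(1,4) total by (simp add: sum_diff1)
    moreover have "0 \<le> (\<Sum>y\<in>A. \<pi> y)"
      using A pos by (intro sum_nonneg) auto
    ultimately show ?thesis
      using h[OF x] by simp
  qed
qed (use assms in auto)

text \<open>
  The set that witnesses the bound is the complement of \<open>z\<close>.
\<close>

lemma tv_dist_cont_ge_point:
  assumes "finite S" "stochastic_kernel S K" "stationary_distribution S K \<pi>" "x \<in> S" "z \<in> S"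
  shows "\<pi> z - heat_kernel S K t x z \<le> tv_dist_cont S K \<pi> t"
  using tv_dist_cont_ge[OF assms(1,4), of "S - {z}" K t \<pi>] assms heat_kernel_row_sum[OF assms(1,2,4), of t]
  by (simp add: sum_diff1 stationary_distribution_def)

section \<open>Product chains\<close>

lemma sum_PiE_prod:
  fixes f :: "nat \<Rightarrow> 'a \<Rightarrow> real"
  assumes "\<And>i. i \<in> {1..n} \<Longrightarrow> finite (X i)"
  shows "(\<Sum>x\<in>product_space n X. \<Prod>i=1..n. f i (x i)) = (\<Prod>i=1..n. \<Sum>y\<in>X i. f i y)"
  unfolding product_space_def by (rule prod_sum_PiE[symmetric]) (use assms in auto)

lemma finite_product_space:
  assumes "\<And>i. i \<in> {1..n} \<Longrightarrow> finite (X i)"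
  shows "finite (product_space n X)"
  unfolding product_space_def by (rule finite_PiE) (use assms in auto)

lemma product_space_component: "x \<in> product_space n X \<Longrightarrow> i \<in> {1..n} \<Longrightarrow> x i \<in> X i"
  by (auto simp: product_space_def)

lemma id_kernel_product:
  assumes "x \<in> product_space n X" "y \<in> product_space n X"
  shows "id_kernel x y = (\<Prod>i=1..n. id_kernel (x i) (y i))"
proof (cases "x = y")
  case False
  then obtain i where "i \<in> {1..n}" "x i \<noteq> y i"
    using assms unfolding product_space_def by (meson PiE_ext)
  then have "(\<Prod>i=1..n. id_kernel (x i) (y i)) = (0::real)"
    by (intro prod_zero) (auto simp: id_kernel_def)
  then show ?thesis using False by (simp add: id_kernel_def)
qed (simp add: id_kernel_def)

text \<open>A one-coordinate move leaves the factors of a product function at the other coordinates alone.\<close>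

lemma product_kernel_apply:
  assumes fin: "\<And>i. i \<in> {1..n} \<Longrightarrow> finite (X i)" and x: "x \<in> product_space n X"
  shows "(\<Sum>z\<in>product_space n X. product_kernel n w K x z * (\<Prod>j=1..n. f j (z j)))
       = (\<Sum>i=1..n. w i * ((\<Sum>y\<in>X i. K i (x i) y * f i y) * (\<Prod>j\<in>{1..n} - {i}. f j (x j))))"
proof -
  have "(\<Sum>z\<in>product_space n X. product_kernel n w K x z * (\<Prod>j=1..n. f j (z j)))
      = (\<Sum>i=1..n. w i * (\<Sum>z\<in>product_space n X.
            \<Prod>j=1..n. ((\<lambda>_. id_kernel)(i := K i)) j (x j) (z j) * f j (z j)))"
    unfolding product_kernel_def tensor_kernel_def prod.distrib sum_distrib_right sum_distrib_left
    by (subst sum.swap) (simp add: mult.assoc)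
  also have "\<dots> = (\<Sum>i=1..n. w i * ((\<Sum>y\<in>X i. K i (x i) y * f i y) * (\<Prod>j\<in>{1..n} - {i}. f j (x j))))"
  proof (intro sum.cong refl arg_cong2[where f = "(*)"])
    fix i assume i: "i \<in> {1..n}"
    have "(\<Sum>z\<in>product_space n X. \<Prod>j=1..n. ((\<lambda>_. id_kernel)(i := K i)) j (x j) (z j) * f j (z j))
        = (\<Prod>j=1..n. \<Sum>y\<in>X j. ((\<lambda>_. id_kernel)(i := K i)) j (x j) y * f j y)"
      by (rule sum_PiE_prod) (rule fin)
    also have "\<dots> = (\<Sum>y\<in>X i. K i (x i) y * f i y) * (\<Prod>j\<in>{1..n} - {i}. \<Sum>y\<in>X j. id_kernel (x j) y * f j y)"
      using i by (subst prod.remove[where x = i]) auto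
    also have "(\<Prod>j\<in>{1..n} - {i}. \<Sum>y\<in>X j. id_kernel (x j) y * f j y) = (\<Prod>j\<in>{1..n} - {i}. f j (x j))"
      by (intro prod.cong refl id_kernel_apply) (use fin product_space_component[OF x] in auto)
    finally show "(\<Sum>z\<in>product_space n X. \<Prod>j=1..n. ((\<lambda>_. id_kernel)(i := K i)) j (x j) (z j) * f j (z j))
        = (\<Sum>y\<in>X i. K i (x i) y * f i y) * (\<Prod>j\<in>{1..n} - {i}. f j (x j))" .
  qed
  finally show ?thesis .
qed

lemma stochastic_product_kernel:
  assumes fin: "\<And>i. i \<in> {1..n} \<Longrightarrow> finite (X i)"
    and K: "\<And>i. i \<in> {1..n} \<Longrightarrow> stochastic_kernel (X i) (K i)"
    and w: "\<And>i. i \<in> {1..n} \<Longrightarrow> 0 \<le> w i" "(\<Sum>i=1..n. w i) = 1"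
  shows "stochastic_kernel (product_space n X) (product_kernel n w K)"
  unfolding stochastic_kernel_def
proof (intro conjI ballI)
  fix x y assume xy: "x \<in> product_space n X" "y \<in> product_space n X"
  show "0 \<le> product_kernel n w K x y"
    unfolding product_kernel_def tensor_kernel_def
  proof (intro sum_nonneg mult_nonneg_nonneg prod_nonneg ballI w)
    fix i j assume "i \<in> {1..n}" "j \<in> {1..n}"
    then show "0 \<le> ((\<lambda>_. id_kernel)(i := K i)) j (x j) (y j)"
      using K xy by (auto simp: id_kernel_def stochastic_kernel_def product_space_component)
  qed
next
  fix x assume x: "x \<in> product_space n X"
  have "(\<Sum>y\<in>product_space n X. product_kernel n w K x y)
      = (\<Sum>i=1..n. w i * (\<Sum>y\<in>X i. K i (x i) y))"
    using product_kernel_apply[OF fin x, of w K "\<lambda>_ _. 1"] by simp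
  also have "\<dots> = (\<Sum>i=1..n. w i)"
    using K product_space_component[OF x] by (intro sum.cong) (auto simp: stochastic_kernel_def)
  finally show "(\<Sum>y\<in>product_space n X. product_kernel n w K x y) = 1"
    using w by simp
qed

lemma stationary_product_dist:
  assumes fin: "\<And>i. i \<in> {1..n} \<Longrightarrow> finite (X i)"
    and \<pi>: "\<And>i. i \<in> {1..n} \<Longrightarrow> stationary_distribution (X i) (K i) (\<pi> i)"
    and w: "(\<Sum>i=1..n. w i) = 1"
  shows "stationary_distribution (product_space n X) (product_kernel n w K) (product_dist n \<pi>)"
  unfolding stationary_distribution_def
proof (intro conjI ballI)
  fix x assume x: "x \<in> product_space n X"
  show "0 \<le> product_dist n \<pi> x"
    unfolding product_dist_def using \<pi> product_space_component[OF x]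
    by (intro prod_nonneg) (auto simp: stationary_distribution_def)
next
  have "(\<Sum>x\<in>product_space n X. product_dist n \<pi> x) = (\<Prod>i=1..n. \<Sum>y\<in>X i. \<pi> i y)"
    unfolding product_dist_def by (rule sum_PiE_prod) (rule fin)
  also have "\<dots> = 1"
    using \<pi> by (intro prod.neutral ballI) (simp add: stationary_distribution_def)
  finally show "(\<Sum>x\<in>product_space n X. product_dist n \<pi> x) = 1" .
next
  fix y assume y: "y \<in> product_space n X"
  have "(\<Sum>x\<in>product_space n X. product_dist n \<pi> x * product_kernel n w K x y)
      = (\<Sum>i=1..n. w i * (\<Sum>x\<in>product_space n X.
            \<Prod>j=1..n. \<pi> j (x j) * ((\<lambda>_. id_kernel)(i := K i)) j (x j) (y j)))"
    unfolding product_dist_def product_kernel_def tensor_kernel_def prod.distrib sum_distrib_left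
    by (subst sum.swap) (simp add: mult.left_commute)
  also have "\<dots> = (\<Sum>i=1..n. w i * product_dist n \<pi> y)"
  proof (intro sum.cong refl arg_cong2[where f = "(*)"])
    fix i assume i: "i \<in> {1..n}"
    have "(\<Sum>x\<in>product_space n X. \<Prod>j=1..n. \<pi> j (x j) * ((\<lambda>_. id_kernel)(i := K i)) j (x j) (y j))
        = (\<Prod>j=1..n. \<Sum>x\<in>X j. \<pi> j x * ((\<lambda>_. id_kernel)(i := K i)) j x (y j))"
      by (rule sum_PiE_prod[where f = "\<lambda>j x. \<pi> j x * ((\<lambda>_. id_kernel)(i := K i)) j x (y j)"]) (rule fin)
    also have "\<dots> = (\<Prod>j=1..n. \<pi> j (y j))"
      using \<pi> fin product_space_component[OF y] i
      by (intro prod.cong refl) (auto simp: id_kernel_apply' stationary_distribution_def)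
    finally show "(\<Sum>x\<in>product_space n X. \<Prod>j=1..n. \<pi> j (x j) * ((\<lambda>_. id_kernel)(i := K i)) j (x j) (y j))
        = product_dist n \<pi> y"
      by (simp add: product_dist_def)
  qed
  also have "\<dots> = product_dist n \<pi> y"
    using w by (simp add: sum_distrib_right[symmetric])
  finally show "(\<Sum>x\<in>product_space n X. product_dist n \<pi> x * product_kernel n w K x y) = product_dist n \<pi> y" .
qed

text \<open>
  In continuous time the coordinates evolve independently, the \<open>i\<close>-th one at speed \<open>w i\<close>:
  by the product rule, the product of the coordinate heat kernels solves the backward equation
  of the product chain.
\<close>

lemma heat_kernel_product:
  assumes fin: "\<And>i. i \<in> {1..n} \<Longrightarrow> finite (X i)"
    and w: "(\<Sum>i=1..n. w i) = 1"
    and x: "x \<in> product_space n X" and y: "y \<in> product_space n X"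
  shows "heat_kernel (product_space n X) (product_kernel n w K) t x y
       = (\<Prod>i=1..n. heat_kernel (X i) (K i) (t * w i) (x i) (y i))"
proof (rule heat_kernel_unique_id[where F = "\<lambda>t x. \<Prod>i=1..n. heat_kernel (X i) (K i) (t * w i) (x i) (y i)",
      OF finite_product_space[OF fin] x y, symmetric], goal_cases)
  case (2 t x)
  let ?H = "\<lambda>i. heat_kernel (X i) (K i) (t * w i)"
  let ?D = "\<lambda>i. (\<Sum>z\<in>X i. K i (x i) z * ?H i z (y i)) - ?H i (x i) (y i)"
  have "((\<lambda>t. heat_kernel (X i) (K i) (t * w i) (x i) (y i)) has_real_derivative ?D i * w i) (at t)"
    if "i \<in> {1..n}" for i
    by (rule DERIV_chain'[where f = "\<lambda>t. t * w i", OF _ heat_kernel_deriv])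
       (use fin that product_space_component[OF 2] product_space_component[OF y]
         in \<open>auto intro!: derivative_eq_intros\<close>)
  then have "((\<lambda>t. \<Prod>i=1..n. heat_kernel (X i) (K i) (t * w i) (x i) (y i)) has_real_derivative
      (\<Sum>i=1..n. ?D i * w i * (\<Prod>j\<in>{1..n} - {i}. ?H j (x j) (y j)))) (at t)"
    by (rule has_field_derivative_prod)
  moreover have "(\<Sum>i=1..n. ?D i * w i * (\<Prod>j\<in>{1..n} - {i}. ?H j (x j) (y j)))
     = (\<Sum>z\<in>product_space n X. product_kernel n w K x z * (\<Prod>i=1..n. ?H i (z i) (y i)))
       - (\<Prod>i=1..n. ?H i (x i) (y i))"
  proof -
    have "?H i (x i) (y i) * w i * (\<Prod>j\<in>{1..n} - {i}. ?H j (x j) (y j)) = w i * (\<Prod>i=1..n. ?H i (x i) (y i))"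
      if "i \<in> {1..n}" for i
      using that by (subst (2) prod.remove[where x = i]) auto
    then have "(\<Sum>i=1..n. ?H i (x i) (y i) * w i * (\<Prod>j\<in>{1..n} - {i}. ?H j (x j) (y j)))
        = (\<Sum>i=1..n. w i * (\<Prod>i=1..n. ?H i (x i) (y i)))"
      by (rule sum.cong[OF refl])
    also have "\<dots> = (\<Prod>i=1..n. ?H i (x i) (y i))"
      unfolding sum_distrib_right[symmetric] w by simp
    finally have "(\<Sum>i=1..n. ?H i (x i) (y i) * w i * (\<Prod>j\<in>{1..n} - {i}. ?H j (x j) (y j)))
        = (\<Prod>i=1..n. ?H i (x i) (y i))" .
    moreover have "?D i * w i * (\<Prod>j\<in>{1..n} - {i}. ?H j (x j) (y j))
        = w i * ((\<Sum>z\<in>X i. K i (x i) z * ?H i z (y i)) * (\<Prod>j\<in>{1..n} - {i}. ?H j (x j) (y j)))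
          - ?H i (x i) (y i) * w i * (\<Prod>j\<in>{1..n} - {i}. ?H j (x j) (y j))" for i
      by (simp add: algebra_simps)
    ultimately show ?thesis
      using product_kernel_apply[OF fin 2, of w K "\<lambda>i z. ?H i z (y i)"]
      by (simp only: sum_subtractf)
  qed
  ultimately show ?case by simp
next
  case (3 x)
  then have "(\<Prod>i=1..n. heat_kernel (X i) (K i) (0 * w i) (x i) (y i)) = (\<Prod>i=1..n. id_kernel (x i) (y i))"
    by (intro prod.cong refl)
       (use fin y in \<open>simp add: heat_kernel_0 product_space_component\<close>)
  then show ?case
    using id_kernel_product[OF 3 y] by simp
qed (use assms in auto)

section \<open>Poisson tails\<close>

text \<open>
  A chain with \<open>n\<close> coordinates needs tail bounds that stay small after multiplication by \<open>n\<close>, which rules out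
  Chebyshev's inequality; the tails are estimated exponentially.
\<close>

definition poisson_prob :: "real \<Rightarrow> nat set \<Rightarrow> real" where
  "poisson_prob u A = (\<Sum>m. poisson_weight u m * of_bool (m \<in> A))"

lemma poisson_prob_sums:
  assumes "0 \<le> u"
  shows "(\<lambda>m. poisson_weight u m * of_bool (m \<in> A)) sums poisson_prob u A"
  unfolding poisson_prob_def
proof (rule summable_sums, rule summable_comparison_test'[where N = 0])
  show "summable (poisson_weight u)"
    using poisson_weight_sums by (rule sums_summable)
qed (use assms in \<open>auto simp: poisson_weight_nonneg\<close>)

text \<open>
  \<open>chernoff_rate s ^ M\<close> is the Chernoff bound for the probability that a Poisson variable with mean \<open>s * M\<close>
  lies on the far side of \<open>M\<close>.
\<close>

definition chernoff_rate :: "real \<Rightarrow> real" where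
  "chernoff_rate s = s * exp (1 - s)"

lemma chernoff_rate_less_1:
  assumes "0 < s" "s \<noteq> 1"
  shows "0 < chernoff_rate s" "chernoff_rate s < 1"
proof -
  have "ln s \<noteq> s - 1" "ln s \<le> s - 1"
    using assms ln_eq_minus_one ln_le_minus_one by auto
  then have "exp (ln s + (1 - s)) < 1" by simp
  then show "chernoff_rate s < 1"
    unfolding exp_add chernoff_rate_def using assms by simp
qed (use assms in \<open>simp add: chernoff_rate_def\<close>)

text \<open>
  Exponential Markov inequality with the multiplier \<open>s\<^sup>-\<^sup>1\<close>, which is optimal when the mean is \<open>s M\<close>.
\<close>

lemma poisson_prob_chernoff:
  assumes u: "0 \<le> u" and s: "0 < s"
    and A: "\<And>m. m \<in> A \<Longrightarrow> 1 \<le> (1 / s) ^ m * s ^ M"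
    and exponent: "u * (1 / s - 1) \<le> real M * (1 - s)"
  shows "poisson_prob u A \<le> chernoff_rate s ^ M"
proof -
  have "poisson_prob u A \<le> exp (u * (1 / s - 1)) * s ^ M"
  proof (rule sums_le[OF _ poisson_prob_sums[OF u] sums_mult2[OF poisson_weight_gf]])
    fix m
    have "of_bool (m \<in> A) \<le> (1 / s) ^ m * s ^ M"
      using A[of m] s by (cases "m \<in> A") auto
    then show "poisson_weight u m * of_bool (m \<in> A) \<le> poisson_weight u m * (1 / s) ^ m * s ^ M"
      using u by (simp only: mult.assoc mult_left_mono poisson_weight_nonneg)
  qed
  also have "\<dots> \<le> exp (real M * (1 - s)) * s ^ M"
    using exponent s by (intro mult_right_mono) auto
  also have "\<dots> = chernoff_rate s ^ M"
    by (simp add: chernoff_rate_def power_mult_distrib exp_of_nat_mult[symmetric])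
  finally show ?thesis .
qed

lemma poisson_lower_tail:
  assumes "1 < s" "s * real M \<le> u"
  shows "poisson_prob u {..M} \<le> chernoff_rate s ^ M"
proof (rule poisson_prob_chernoff)
  have "0 \<le> s * real M" using assms by simp
  then show "0 \<le> u" using assms by linarith
  show "1 \<le> (1 / s) ^ m * s ^ M" if "m \<in> {..M}" for m
    using that assms power_increasing[of m M s] by (simp add: power_divide field_simps)
  have "u * (1 / s - 1) \<le> s * real M * (1 / s - 1)"
    using assms by (intro mult_right_mono_neg) auto
  moreover have "s * real M * (1 / s - 1) = real M * (1 - s)"
    using assms by (simp add: field_simps)
  ultimately show "u * (1 / s - 1) \<le> real M * (1 - s)"
    by simp
qed (use assms in auto)

lemma poisson_upper_tail:
  assumes "0 < s" "s < 1" "0 \<le> u" "u \<le> s * real M"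
  shows "poisson_prob u {M..} \<le> chernoff_rate s ^ M"
proof (rule poisson_prob_chernoff)
  show "1 \<le> (1 / s) ^ m * s ^ M" if "m \<in> {M..}" for m
    using that assms power_decreasing[of M m s] by (simp add: power_divide field_simps)
  have "u * (1 / s - 1) \<le> s * real M * (1 / s - 1)"
    using assms by (intro mult_right_mono) auto
  moreover have "s * real M * (1 / s - 1) = real M * (1 - s)"
    using assms by (simp add: field_simps)
  ultimately show "u * (1 / s - 1) \<le> real M * (1 - s)"
    by simp
qed (use assms in auto)

section \<open>The chain on one coordinate\<close>

lemma kernel_pow_Suc_ge:
  assumes "finite S" "stochastic_kernel S K" "x \<in> S" "y \<in> S" "B \<subseteq> S"
  shows "(\<Sum>z\<in>B. K x z * kernel_pow S K m z y) \<le> kernel_pow S K (Suc m) x y"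
  unfolding kernel_pow_Suc_left[OF assms(1,3,4)]
  by (rule sum_mono2)
     (use assms in \<open>auto intro!: mult_nonneg_nonneg kernel_pow_nonneg simp: stochastic_kernel_def\<close>)

lemma kernel_pow_Suc_ge_right:
  assumes "finite S" "stochastic_kernel S K" "x \<in> S" "y \<in> S" "z \<in> S"
  shows "kernel_pow S K m x z * K z y \<le> kernel_pow S K (Suc m) x y"
  unfolding kernel_pow.simps kernel_mult_def
  by (rule member_le_sum)
     (use assms in \<open>auto intro!: mult_nonneg_nonneg kernel_pow_nonneg simp: stochastic_kernel_def\<close>)

lemma kernel_pow_row_sum:
  assumes "finite S" "stochastic_kernel S K" "x \<in> S"
  shows "(\<Sum>y\<in>S. kernel_pow S K m x y) = 1"
proof (induction m)
  case 0
  then show ?case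
    using id_kernel_apply[OF assms(1,3), of "\<lambda>_. 1"] by simp
next
  case (Suc m)
  have "(\<Sum>y\<in>S. kernel_pow S K (Suc m) x y) = (\<Sum>z\<in>S. kernel_pow S K m x z * (\<Sum>y\<in>S. K z y))"
    unfolding kernel_pow.simps kernel_mult_def by (subst sum.swap) (simp add: sum_distrib_left)
  also have "\<dots> = 1"
    using assms Suc by (simp add: stochastic_kernel_def)
  finally show ?case .
qed

lemma heat_kernel_ge:
  assumes "finite S" "x \<in> S" "y \<in> S" "0 \<le> u"
    and "\<And>m. f m \<le> kernel_pow S K m x y"
    and "(\<lambda>m. poisson_weight u m * f m) sums s"
  shows "s \<le> heat_kernel S K u x y"
  by (rule sums_le[OF _ assms(6) heat_kernel_poisson[OF assms(1-3)]])
     (intro mult_left_mono assms poisson_weight_nonneg)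

lemma heat_kernel_le:
  assumes "finite S" "x \<in> S" "y \<in> S" "0 \<le> u"
    and "\<And>m. kernel_pow S K m x y \<le> f m"
    and "(\<lambda>m. poisson_weight u m * f m) sums s"
  shows "heat_kernel S K u x y \<le> s"
  by (rule sums_le[OF _ heat_kernel_poisson[OF assms(1-3)] assms(6)])
     (intro mult_left_mono assms poisson_weight_nonneg)

text \<open>
  The chain climbs from \<open>0\<close> to \<open>n\<close>; there it jumps to \<open>2 * n\<close>, or, with probability \<open>b\<close>, takes the detour through
  \<open>n + 1, \<dots>, 2 * n - 1\<close>, which doubles the time needed.  Steps against this direction have probability at most \<open>a\<close>
  each.
\<close>

locale detour_chain =
  fixes n :: nat and a b c :: real
  assumes n: "2 \<le> n"
    and a: "0 \<le> a" "a < b" "a + b < 1 / 2"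
    and c: "0 \<le> c" "c \<le> a"
    and stoch: "stochastic_kernel {0..2 * n} (param_kernel n a b c)"
begin

abbreviation S :: "nat set" where "S \<equiv> {0..2 * n}"
abbreviation K :: "nat \<Rightarrow> nat \<Rightarrow> real" where "K \<equiv> param_kernel n a b c"
abbreviation Kpow :: "nat \<Rightarrow> nat \<Rightarrow> nat \<Rightarrow> real" where "Kpow \<equiv> kernel_pow S K"
abbreviation H :: "real \<Rightarrow> nat \<Rightarrow> nat \<Rightarrow> real" where "H \<equiv> heat_kernel S K"

lemma K_up: "x \<noteq> n \<Longrightarrow> x \<noteq> 2 * n \<Longrightarrow> K x (Suc x) = 1 - a"
  using n by (auto simp: param_kernel_def)

lemma K_branch: "K n (Suc n) = b" "K n (2 * n) = 1 - a - b"
  using n by (auto simp: param_kernel_def)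

lemma K_top: "K (2 * n) (2 * n) = 1 - a - c"
  using n by (auto simp: param_kernel_def)

lemma pow_ge: "x \<in> S \<Longrightarrow> B \<subseteq> S \<Longrightarrow> (\<Sum>z\<in>B. K x z * Kpow m z (2 * n)) \<le> Kpow (Suc m) x (2 * n)"
  by (rule kernel_pow_Suc_ge) (use stoch in auto)

lemma pow_ge_single: "x \<in> S \<Longrightarrow> z \<in> S \<Longrightarrow> K x z * Kpow m z (2 * n) \<le> Kpow (Suc m) x (2 * n)"
  using pow_ge[of x "{z}" m] by simp

lemma Kpow_nonneg: "x \<in> S \<Longrightarrow> y \<in> S \<Longrightarrow> 0 \<le> Kpow m x y"
  using kernel_pow_nonneg[OF stoch] by blast

text \<open>
  From every state the next step goes forward, or stays at \<open>2 * n\<close>, with probability at least \<open>1 - 2 * a\<close>; at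
  \<open>n\<close> both branches count as forward.  A walk with only such steps is at \<open>2 * n\<close> after any number of
  steps from \<open>2 * n - x\<close> on, whichever branch it takes.
\<close>

lemma pow_top_ge_long:
  assumes "x \<in> S" "2 * n - x \<le> m"
  shows "(1 - 2 * a) ^ m \<le> Kpow m x (2 * n)"
  using assms
proof (induction m arbitrary: x)
  case 0
  then show ?case by (simp add: id_kernel_def)
next
  case (Suc m)
  have a2: "0 \<le> (1 - 2 * a) ^ m" using a by simp
  consider "x = 2 * n" | "x = n" | "x \<noteq> n" "x < 2 * n" using Suc.prems by force
  then show ?case
  proof cases
    case 1
    have "(1 - 2 * a) * (1 - 2 * a) ^ m \<le> (1 - a - c) * Kpow m (2 * n) (2 * n)"
      using a c by (intro mult_mono Suc.IH) auto
    then show ?thesis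
      using pow_ge_single[of "2 * n" "2 * n" m] 1 by (simp add: K_top)
  next
    case 2
    have "(1 - 2 * a) * (1 - 2 * a) ^ m \<le> (1 - a) * (1 - 2 * a) ^ m"
      using a a2 by (intro mult_right_mono) auto
    also have "\<dots> = b * (1 - 2 * a) ^ m + (1 - a - b) * (1 - 2 * a) ^ m"
      by (simp add: algebra_simps)
    also have "\<dots> \<le> b * Kpow m (Suc n) (2 * n) + (1 - a - b) * Kpow m (2 * n) (2 * n)"
      using a Suc.prems 2 n by (intro add_mono mult_left_mono Suc.IH) auto
    also have "\<dots> = (\<Sum>z\<in>{Suc n, 2 * n}. K n z * Kpow m z (2 * n))"
      using n by (simp add: K_branch)
    also have "\<dots> \<le> Kpow (Suc m) n (2 * n)"
      by (rule pow_ge) (use n in auto)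
    finally show ?thesis using 2 by simp
  next
    case 3
    have "(1 - 2 * a) * (1 - 2 * a) ^ m \<le> (1 - a) * Kpow m (Suc x) (2 * n)"
      using a a2 3 Suc.prems by (intro mult_mono Suc.IH) auto
    then show ?thesis
      using pow_ge_single[of x "Suc x" m] 3 by (simp add: K_up)
  qed
qed

text \<open>
  Excluding the branch through \<open>n + 1\<close> costs a factor \<open>1 - b\<close>; the walk then jumps from \<open>n\<close> to \<open>2 * n\<close> and needs
  only \<open>n + 1 - x\<close> steps.
\<close>

lemma pow_top_ge_short_aux:
  assumes "x \<le> n" "n < m + x"
  shows "(1 - b) * (1 - 2 * a) ^ m \<le> Kpow m x (2 * n)"
  using assms
proof (induction m arbitrary: x)
  case (Suc m)
  have a2: "0 \<le> (1 - 2 * a) ^ m" using a by simp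
  show ?case
  proof (cases "x = n")
    case True
    \<comment> \<open>The inequality \<open>(1 - b) * (1 - 2 * a) \<le> 1 - a - b\<close> amounts to \<open>2 * a * b \<le> a\<close>.\<close>
    have "a * b \<le> a * (1 / 2)" using a by (intro mult_left_mono) auto
    then have "(1 - b) * (1 - 2 * a) \<le> 1 - a - b"
      by (simp add: algebra_simps)
    then have "((1 - b) * (1 - 2 * a)) * (1 - 2 * a) ^ m \<le> (1 - a - b) * Kpow m (2 * n) (2 * n)"
      using a by (intro mult_mono pow_top_ge_long) auto
    then show ?thesis
      using pow_ge_single[of n "2 * n" m] True by (simp add: K_branch mult.assoc)
  next
    case False
    have "(1 - 2 * a) * ((1 - b) * (1 - 2 * a) ^ m) \<le> (1 - a) * Kpow m (Suc x) (2 * n)"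
      using a a2 False Suc.prems by (intro mult_mono Suc.IH) auto
    then show ?thesis
      using pow_ge_single[of x "Suc x" m] False Suc.prems n by (simp add: K_up mult_ac)
  qed
qed simp

lemma pow_top_ge_short:
  assumes "x \<in> S" "n < m"
  shows "(1 - b) * (1 - 2 * a) ^ m \<le> Kpow m x (2 * n)"
proof (cases "x \<le> n")
  case False
  have "(1 - b) * (1 - 2 * a) ^ m \<le> 1 * (1 - 2 * a) ^ m"
    using a by (intro mult_right_mono) auto
  also have "\<dots> \<le> Kpow m x (2 * n)"
    using pow_top_ge_long[of x m] assms False by simp
  finally show ?thesis .
qed (use assms pow_top_ge_short_aux in auto)

lemma pow_unreached:
  assumes "m \<le> n" "m < y" "y \<in> S"
  shows "Kpow m 0 y = 0"
  using assms
proof (induction m arbitrary: y)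
  case 0
  then show ?case by (simp add: id_kernel_def)
next
  case (Suc m)
  have "Kpow m 0 z * K z y = 0" if "z \<in> S" for z
  proof (cases "m < z")
    case True
    then show ?thesis using Suc that by simp
  next
    case False
    then have "K z y = 0" using Suc.prems by (auto simp: param_kernel_def)
    then show ?thesis by simp
  qed
  then show ?case unfolding kernel_pow.simps kernel_mult_def by (intro sum.neutral ballI)
qed

lemma pow_diagonal_ge:
  assumes "m \<le> n"
  shows "(1 - a) ^ m \<le> Kpow m 0 m"
  using assms
proof (induction m)
  case 0
  then show ?case by (simp add: id_kernel_def)
next
  case (Suc m)
  have "(1 - a) ^ m * (1 - a) \<le> Kpow m 0 m * K m (Suc m)"
    using a Suc by (simp add: K_up mult_right_mono)
  also have "\<dots> \<le> Kpow (Suc m) 0 (Suc m)"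
    by (rule kernel_pow_Suc_ge_right) (use stoch Suc.prems in auto)
  finally show ?case by (simp add: mult_ac)
qed

lemma pow_detour_ge:
  assumes "n < m" "m \<le> 2 * n"
  shows "b * (1 - a) ^ (m - 1) \<le> Kpow m 0 m"
  using assms
proof (induction m)
  case (Suc m)
  have step: "Kpow m 0 m * K m (Suc m) \<le> Kpow (Suc m) 0 (Suc m)"
    by (rule kernel_pow_Suc_ge_right) (use stoch Suc.prems in auto)
  show ?case
  proof (cases "m = n")
    case True
    have "b * (1 - a) ^ n \<le> Kpow n 0 n * K n (Suc n)"
      using mult_right_mono[OF pow_diagonal_ge[of n], of b] a by (simp only: K_branch mult.commute)
    then show ?thesis
      using step True by simp
  next
    case False
    then have "b * (1 - a) ^ (m - 1) * (1 - a) \<le> Kpow m 0 m * K m (Suc m)"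
      using a Suc by (simp add: K_up mult_right_mono)
    moreover have "(1 - a) ^ (m - 1) * (1 - a) = (1 - a) ^ m"
      using Suc.prems False n by (cases m) auto
    ultimately show ?thesis using step by (simp add: mult.assoc)
  qed
qed simp

text \<open>
  A walk from \<open>0\<close> that entered the long branch and never turned back is at the state \<open>m\<close>, short of \<open>2 * n\<close>.
\<close>

lemma pow_top_le_detour:
  assumes "n < m" "m < 2 * n"
  shows "Kpow m 0 (2 * n) \<le> 1 - b * (1 - 2 * real n * a)"
proof -
  have "Kpow m 0 m + Kpow m 0 (2 * n) = (\<Sum>y\<in>{m, 2 * n}. Kpow m 0 y)"
    using assms by simp
  also have "\<dots> \<le> (\<Sum>y\<in>S. Kpow m 0 y)"
    by (rule sum_mono2) (use assms in \<open>auto intro!: Kpow_nonneg\<close>)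
  also have "\<dots> = 1"
    by (rule kernel_pow_row_sum) (use stoch in auto)
  finally have "Kpow m 0 (2 * n) \<le> 1 - Kpow m 0 m" by simp
  moreover have "b * (1 - 2 * real n * a) \<le> Kpow m 0 m"
  proof -
    have "1 + real (m - 1) * (- a) \<le> (1 + (- a)) ^ (m - 1)"
      by (rule Bernoulli_inequality) (use a in auto)
    moreover have "real (m - 1) * a \<le> 2 * real n * a"
      using assms a by (intro mult_right_mono) auto
    ultimately have "b * (1 - 2 * real n * a) \<le> b * (1 - a) ^ (m - 1)"
      using a by (intro mult_left_mono) auto
    then show ?thesis using pow_detour_ge[of m] assms by simp
  qed
  ultimately show ?thesis by simp
qed

text \<open>
  After \<open>m > M\<close> steps the factor \<open>(1 - 2 * a) ^ m\<close> loses at most \<open>2 * a * m\<close> by Bernoulli's inequality.  The number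
  of steps by time \<open>u\<close> has mean \<open>u\<close>, so on average this is a loss of \<open>2 * a * u\<close>.
\<close>

lemma heat_top_ge_aux:
  assumes x: "x \<in> S" and u: "0 \<le> u" and \<beta>: "0 \<le> \<beta>"
    and pow: "\<And>m. M < m \<Longrightarrow> \<beta> * (1 - 2 * a) ^ m \<le> Kpow m x (2 * n)"
  shows "\<beta> * (1 - 2 * a * u - poisson_prob u {..M}) \<le> H u x (2 * n)"
proof (rule heat_kernel_ge)
  fix m
  show "\<beta> * (1 - 2 * a * real m - of_bool (m \<in> {..M})) \<le> Kpow m x (2 * n)"
  proof (cases "m \<le> M")
    case True
    have "\<beta> * (1 - 2 * a * real m - of_bool (m \<in> {..M})) \<le> 0"
      using True \<beta> a by (simp add: mult_nonneg_nonpos2 mult_nonneg_nonpos)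
    then show ?thesis using Kpow_nonneg[OF x, of "2 * n" m] by simp
  next
    case False
    have "1 + real m * (- (2 * a)) \<le> (1 + (- (2 * a))) ^ m"
      by (rule Bernoulli_inequality) (use a in auto)
    then have "\<beta> * (1 - 2 * a * real m) \<le> \<beta> * (1 - 2 * a) ^ m"
      using \<beta> by (intro mult_left_mono) (auto simp: mult_ac)
    then show ?thesis using pow[of m] False by simp
  qed
next
  have "(\<lambda>m. \<beta> * (poisson_weight u m - 2 * a * (poisson_weight u m * real m)
              - poisson_weight u m * of_bool (m \<in> {..M})))
          sums (\<beta> * (1 - 2 * a * u - poisson_prob u {..M}))"
    by (intro sums_mult sums_diff poisson_weight_sums poisson_weight_mean poisson_prob_sums u)
  then show "(\<lambda>m. poisson_weight u m * (\<beta> * (1 - 2 * a * real m - of_bool (m \<in> {..M}))))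
          sums (\<beta> * (1 - 2 * a * u - poisson_prob u {..M}))"
    by (simp add: algebra_simps)
qed (use x u in auto)

lemma heat_top_ge_short:
  assumes "1 < s" "s * real n \<le> u" "x \<in> S"
  shows "(1 - b) * (1 - 2 * a * (s * real n) - chernoff_rate s ^ n) \<le> H u x (2 * n)"
proof (rule heat_kernel_ge_later[where s = "s * real n"])
  fix x assume x: "x \<in> S"
  have "(1 - b) * (1 - 2 * a * (s * real n) - chernoff_rate s ^ n)
      \<le> (1 - b) * (1 - 2 * a * (s * real n) - poisson_prob (s * real n) {..n})"
    using a poisson_lower_tail[of s n "s * real n"] assms by (intro mult_left_mono) auto
  also have "\<dots> \<le> H (s * real n) x (2 * n)"
    by (rule heat_top_ge_aux) (use assms a x pow_top_ge_short in auto)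
  finally show "(1 - b) * (1 - 2 * a * (s * real n) - chernoff_rate s ^ n) \<le> H (s * real n) x (2 * n)" .
qed (use assms stoch in auto)

lemma heat_top_ge_long:
  assumes "1 < s" "s * (2 * real n) \<le> u" "x \<in> S"
  shows "1 - 2 * a * (s * (2 * real n)) - chernoff_rate s ^ (2 * n) \<le> H u x (2 * n)"
proof (rule heat_kernel_ge_later[where s = "s * (2 * real n)"])
  fix x assume x: "x \<in> S"
  have "1 - 2 * a * (s * (2 * real n)) - chernoff_rate s ^ (2 * n)
      \<le> 1 * (1 - 2 * a * (s * (2 * real n)) - poisson_prob (s * (2 * real n)) {..2 * n})"
    using poisson_lower_tail[of s "2 * n" "s * (2 * real n)"] assms by simp
  also have "\<dots> \<le> H (s * (2 * real n)) x (2 * n)"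
    by (rule heat_top_ge_aux) (use assms x in \<open>auto intro!: pow_top_ge_long\<close>)
  finally show "1 - 2 * a * (s * (2 * real n)) - chernoff_rate s ^ (2 * n) \<le> H (s * (2 * real n)) x (2 * n)" .
qed (use assms stoch in auto)

lemma heat_top_le_early:
  assumes "0 < s" "s < 1" "0 \<le> u" "u \<le> s * real n"
  shows "H u 0 (2 * n) \<le> chernoff_rate s ^ n"
proof -
  have "H u 0 (2 * n) \<le> poisson_prob u {n..}"
  proof (rule heat_kernel_le)
    fix m
    have "Kpow m 0 (2 * n) \<le> (\<Sum>y\<in>S. Kpow m 0 y)"
      by (rule member_le_sum) (auto intro!: Kpow_nonneg)
    also have "\<dots> = 1"
      by (rule kernel_pow_row_sum) (use stoch in auto)
    finally show "Kpow m 0 (2 * n) \<le> of_bool (m \<in> {n..})"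
      using pow_unreached[of m "2 * n"] n by (cases "n \<le> m") auto
  qed (use assms poisson_prob_sums[of u "{n..}"] in auto)
  also have "\<dots> \<le> chernoff_rate s ^ n"
    by (rule poisson_upper_tail) (use assms in auto)
  finally show ?thesis .
qed

text \<open>
  The number of steps by time \<open>u\<close> lies strictly between \<open>n\<close> and \<open>2 * n\<close> up to the two tails.  When it does, the
  chain started at \<open>0\<close> is still on the long branch with probability at least \<open>b * (1 - 2 * n * a)\<close>.
\<close>

lemma heat_top_le_detour:
  assumes s: "1 < s" "s * real n \<le> u" and r: "0 < r" "r < 1" "u \<le> r * (2 * real n)"
    and small: "2 * real n * a \<le> 1"
  shows "H u 0 (2 * n) \<le> 1 - b * ((1 - 2 * real n * a) * (1 - chernoff_rate s ^ n - chernoff_rate r ^ (2 * n)))"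
proof -
  define \<kappa> where "\<kappa> = b * (1 - 2 * real n * a)"
  have u: "0 \<le> u"
    by (rule order_trans[OF _ s(2)]) (use s in simp)
  have \<kappa>: "0 \<le> \<kappa>" unfolding \<kappa>_def using a small by simp
  have "H u 0 (2 * n) \<le> 1 - \<kappa> * (1 - poisson_prob u {..n} - poisson_prob u {2 * n..})"
  proof (rule heat_kernel_le)
    fix m
    have "Kpow m 0 (2 * n) \<le> (\<Sum>y\<in>S. Kpow m 0 y)"
      by (rule member_le_sum) (auto intro!: Kpow_nonneg)
    also have "\<dots> = 1"
      by (rule kernel_pow_row_sum) (use stoch in auto)
    finally have "Kpow m 0 (2 * n) \<le> 1" .
    moreover consider "m \<le> n" | "n < m" "m < 2 * n" | "n < m" "2 * n \<le> m" by linarith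
    ultimately show "Kpow m 0 (2 * n) \<le> 1 - \<kappa> * (1 - of_bool (m \<in> {..n}) - of_bool (m \<in> {2 * n..}))"
      by (cases; use pow_top_le_detour[of m, folded \<kappa>_def] n \<kappa> in auto)
  next
    have "(\<lambda>m. poisson_weight u m - \<kappa> * (poisson_weight u m - poisson_weight u m * of_bool (m \<in> {..n})
              - poisson_weight u m * of_bool (m \<in> {2 * n..})))
          sums (1 - \<kappa> * (1 - poisson_prob u {..n} - poisson_prob u {2 * n..}))"
      by (intro sums_mult sums_diff poisson_weight_sums poisson_prob_sums u)
    then show "(\<lambda>m. poisson_weight u m * (1 - \<kappa> * (1 - of_bool (m \<in> {..n}) - of_bool (m \<in> {2 * n..}))))
          sums (1 - \<kappa> * (1 - poisson_prob u {..n} - poisson_prob u {2 * n..}))"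
      by (simp only: right_diff_distrib mult_1_right mult.left_commute mult.commute[of _ \<kappa>])
  qed (use u in auto)
  also have "\<dots> \<le> 1 - \<kappa> * (1 - chernoff_rate s ^ n - chernoff_rate r ^ (2 * n))"
    using poisson_lower_tail[of s n u] poisson_upper_tail[of r u "2 * n"] s r u \<kappa>
    by (intro diff_left_mono mult_left_mono) auto
  finally show ?thesis by (simp add: \<kappa>_def mult.assoc)
qed

end

text \<open>
  The parameter \<open>c\<close> is not free: reversibility gives \<open>c = (1 - a - b) * a ^ n / (b * (1 - a) ^ (n - 1))\<close>, and since
  \<open>a < b\<close> and \<open>a < 1 / 2\<close> this is at most \<open>a\<close>.  Hence \<open>a\<close> alone controls all moves away from \<open>2 * n\<close>.
\<close>

lemma detour_chainI:
  assumes n: "2 \<le> n" and ab: "a < b" "a + b < 1 / 2"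
    and chain: "irreducible_reversible_chain {0..2 * n} (param_kernel n a b c) \<pi>"
  shows "detour_chain n a b c"
proof
  show st: "stochastic_kernel {0..2 * n} (param_kernel n a b c)"
    using chain by (simp add: irreducible_reversible_chain_def)
  have "0 \<le> param_kernel n a b c 0 0" "0 \<le> param_kernel n a b c (2 * n) n"
    using st by (auto simp: stochastic_kernel_def)
  then show a: "0 \<le> a" and c: "0 \<le> c"
    using n by (auto simp: param_kernel_def)
  have rel: "b * c * (1 - a) ^ (n - 1) = (1 - a - b) * a ^ n"
    by (rule param_kernel_relation[OF n chain])
  obtain k where k: "n = Suc (Suc k)"
    using n by (metis Suc_le_D numeral_2_eq_2 Suc_le_mono)
  have "(1 - a - b) * a ^ Suc k \<le> (1 - a) * (b * (1 - a) ^ k)"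
    unfolding power_Suc using a ab by (intro mult_mono power_mono) auto
  then have "(1 - a - b) * a ^ Suc k * a \<le> (1 - a) * (b * (1 - a) ^ k) * a"
    using a by (rule mult_right_mono)
  then have "(b * (1 - a) ^ Suc k) * c \<le> (b * (1 - a) ^ Suc k) * a"
    using rel k by (simp add: mult_ac)
  moreover have "0 < b * (1 - a) ^ Suc k"
    using a ab by simp
  ultimately show "c \<le> a"
    by (rule mult_left_le_imp_le)
qed (use n ab in auto)

section \<open>The distance of the product chain\<close>

text \<open>
  Weierstrass' product inequality, written for the factors themselves.
\<close>

lemma prod_ge_one_minus_sum:
  fixes h :: "'i \<Rightarrow> real"
  assumes "finite I" "\<And>i. i \<in> I \<Longrightarrow> 0 \<le> h i \<and> h i \<le> 1"
  shows "1 - (\<Sum>i\<in>I. 1 - h i) \<le> (\<Prod>i\<in>I. h i)"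
  using assms
proof (induction I)
  case (insert i I)
  have "0 \<le> (1 - h i) * (1 - (\<Prod>i\<in>I. h i))"
    using insert.prems by (intro mult_nonneg_nonneg) (auto intro: prod_le_1)
  then show ?case
    using insert by (simp add: algebra_simps)
qed simp

lemma exp_neg_twice_le:
  fixes x :: real
  assumes "0 \<le> x" "x \<le> 1 / 2"
  shows "exp (- (2 * x)) \<le> 1 - x"
proof -
  have "1 + 2 * x \<le> exp (2 * x)" by (rule exp_ge_add_one_self)
  moreover have "1 \<le> (1 - x) * (1 + 2 * x)"
  proof -
    have "0 \<le> x * (1 - 2 * x)" using assms by simp
    then show ?thesis by (simp add: algebra_simps)
  qed
  moreover have "(1 - x) * (1 + 2 * x) \<le> (1 - x) * exp (2 * x)"
    using assms by (intro mult_left_mono exp_ge_add_one_self) auto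
  ultimately have "1 \<le> (1 - x) * exp (2 * x)" by linarith
  then show ?thesis
    by (simp add: exp_minus inverse_eq_divide divide_le_eq)
qed

locale detour_family =
  fixes p a b c :: "nat \<Rightarrow> nat \<Rightarrow> real"
    and \<pi> :: "nat \<Rightarrow> nat \<Rightarrow> nat \<Rightarrow> real"
  assumes p_pos: "2 \<le> n \<Longrightarrow> i \<in> {1..n} \<Longrightarrow> 0 < p n i"
    and chain: "2 \<le> n \<Longrightarrow> i \<in> {1..n} \<Longrightarrow>
      irreducible_reversible_chain {0..2 * n} (param_kernel n (a n i) (b n i) (c n i)) (\<pi> n i)"
    and a_less_b: "2 \<le> n \<Longrightarrow> i \<in> {1..n} \<Longrightarrow> a n i < b n i"
    and a_plus_b: "2 \<le> n \<Longrightarrow> i \<in> {1..n} \<Longrightarrow> a n i + b n i < 1 / 2"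
    and sum_a: "(\<lambda>n. \<Sum>i=1..n. a n i) \<in> o(\<lambda>n. 1 / real n)"
begin

definition q :: "nat \<Rightarrow> real" where "q n = (\<Sum>j=1..n. p n j)"

text \<open>The time in which the slowest coordinate makes \<open>n\<close> steps on average.\<close>

definition \<tau> :: "nat \<Rightarrow> real" where "\<tau> n = real n * q n / p_min p n"

abbreviation \<H> :: "nat \<Rightarrow> nat \<Rightarrow> real \<Rightarrow> nat \<Rightarrow> nat \<Rightarrow> real" where
  "\<H> n i \<equiv> heat_kernel {0..2 * n} (param_kernel n (a n i) (b n i) (c n i))"

abbreviation d :: "nat \<Rightarrow> real \<Rightarrow> real" where "d \<equiv> product_tv p a b c \<pi>"

abbreviation space :: "nat \<Rightarrow> (nat \<Rightarrow> nat) set" where "space n \<equiv> product_space n (\<lambda>i. {0..2 * n})"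

abbreviation kern :: "nat \<Rightarrow> (nat \<Rightarrow> nat) \<Rightarrow> (nat \<Rightarrow> nat) \<Rightarrow> real" where
  "kern n \<equiv> product_kernel n (\<lambda>i. p n i / q n) (\<lambda>i. param_kernel n (a n i) (b n i) (c n i))"

lemma d_eq: "d n = tv_dist_cont (space n) (kern n) (product_dist n (\<pi> n))"
  by (rule ext) (simp add: product_tv_def q_def)

lemma detour: "2 \<le> n \<Longrightarrow> i \<in> {1..n} \<Longrightarrow> detour_chain n (a n i) (b n i) (c n i)"
  using chain a_less_b a_plus_b by (blast intro: detour_chainI)

lemma coordinate_stochastic:
  "2 \<le> n \<Longrightarrow> i \<in> {1..n} \<Longrightarrow> stochastic_kernel {0..2 * n} (param_kernel n (a n i) (b n i) (c n i))"
  using chain[of n i] unfolding irreducible_reversible_chain_def by blast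

lemma coordinate_stationary:
  "2 \<le> n \<Longrightarrow> i \<in> {1..n} \<Longrightarrow>
     stationary_distribution {0..2 * n} (param_kernel n (a n i) (b n i) (c n i)) (\<pi> n i)"
  using chain[of n i] unfolding irreducible_reversible_chain_def by blast

lemma a_nonneg: "2 \<le> n \<Longrightarrow> i \<in> {1..n} \<Longrightarrow> 0 \<le> a n i"
  using detour_chain.a(1)[OF detour] .

lemma b_pos: "2 \<le> n \<Longrightarrow> i \<in> {1..n} \<Longrightarrow> 0 < b n i"
  using a_nonneg[of n i] a_less_b[of n i] by linarith

lemma b_less: "2 \<le> n \<Longrightarrow> i \<in> {1..n} \<Longrightarrow> b n i < 1 / 2"
  using a_nonneg[of n i] a_plus_b[of n i] by linarith

lemma p_min_le: "i \<in> {1..n} \<Longrightarrow> p_min p n \<le> p n i"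
  unfolding p_min_def by (rule Min_le) auto

lemma p_min_attained:
  assumes "2 \<le> n" obtains i where "i \<in> {1..n}" "p n i = p_min p n"
proof -
  have "p_min p n \<in> p n ` {1..n}"
    unfolding p_min_def by (rule Min_in) (use assms in auto)
  then show ?thesis using that by auto
qed

lemma p_min_pos: "2 \<le> n \<Longrightarrow> 0 < p_min p n"
  by (metis p_min_attained p_pos)

lemma q_pos: "2 \<le> n \<Longrightarrow> 0 < q n"
  unfolding q_def by (rule sum_pos) (use p_pos in auto)

lemma \<tau>_pos: "2 \<le> n \<Longrightarrow> 0 < \<tau> n"
  using p_min_pos[of n] q_pos[of n] by (simp add: \<tau>_def)

lemma coordinate_time: "2 \<le> n \<Longrightarrow> s * \<tau> n * (p n i / q n) = s * real n * (p n i / p_min p n)"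
  using q_pos[of n] by (simp add: \<tau>_def)

lemma weights: "2 \<le> n \<Longrightarrow> i \<in> {1..n} \<Longrightarrow> 0 \<le> p n i / q n" "2 \<le> n \<Longrightarrow> (\<Sum>i=1..n. p n i / q n) = 1"
  using q_pos[of n] p_pos[of n i]
  by (simp_all add: sum_divide_distrib[symmetric] q_def less_imp_le)

lemma coordinate_time_nonneg: "2 \<le> n \<Longrightarrow> i \<in> {1..n} \<Longrightarrow> 0 \<le> s \<Longrightarrow> 0 \<le> s * \<tau> n * (p n i / q n)"
  by (intro mult_nonneg_nonneg weights less_imp_le[OF \<tau>_pos])

lemma finite_space: "finite (space n)"
  by (rule finite_product_space) auto

lemma space_nonempty: "space n \<noteq> {}"
  by (simp add: product_space_def PiE_eq_empty_iff)

lemma kern_stochastic: "2 \<le> n \<Longrightarrow> stochastic_kernel (space n) (kern n)"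
  by (rule stochastic_product_kernel) (use coordinate_stochastic weights in auto)

lemma kern_stationary: "2 \<le> n \<Longrightarrow> stationary_distribution (space n) (kern n) (product_dist n (\<pi> n))"
  by (rule stationary_product_dist) (use coordinate_stationary weights in auto)

lemma heat_kernel_kern:
  assumes "2 \<le> n" "x \<in> space n" "y \<in> space n"
  shows "heat_kernel (space n) (kern n) t x y = (\<Prod>i=1..n. \<H> n i (t * (p n i / q n)) (x i) (y i))"
  by (rule heat_kernel_product) (use assms weights in auto)

lemma d_nonneg: "0 \<le> d n t"
  unfolding d_eq by (rule tv_dist_cont_nonneg[OF finite_space space_nonempty])

lemma d_antimono: "2 \<le> n \<Longrightarrow> 0 \<le> s \<Longrightarrow> s \<le> t \<Longrightarrow> d n t \<le> d n s"
  unfolding d_eq by (rule tv_dist_cont_antimono[OF finite_space space_nonempty kern_stochastic])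

definition top_state :: "nat \<Rightarrow> nat \<Rightarrow> nat" where "top_state n = (\<lambda>i\<in>{1..n}. 2 * n)"
definition bottom_state :: "nat \<Rightarrow> nat \<Rightarrow> nat" where "bottom_state n = (\<lambda>i\<in>{1..n}. 0)"

lemma top_bottom_in: "top_state n \<in> space n" "bottom_state n \<in> space n"
  by (auto simp: top_state_def bottom_state_def product_space_def)

lemma heat_nonneg: "2 \<le> n \<Longrightarrow> i \<in> {1..n} \<Longrightarrow> x \<le> 2 * n \<Longrightarrow> 0 \<le> t \<Longrightarrow> 0 \<le> \<H> n i t x (2 * n)"
  by (intro heat_kernel_nonneg coordinate_stochastic) auto

lemma heat_le_1: "2 \<le> n \<Longrightarrow> i \<in> {1..n} \<Longrightarrow> x \<le> 2 * n \<Longrightarrow> 0 \<le> t \<Longrightarrow> \<H> n i t x (2 * n) \<le> 1"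
  by (intro heat_kernel_le_1 coordinate_stochastic) auto

lemma heat_kernel_top_ge:
  assumes n: "2 \<le> n" and x: "x \<in> space n"
    and h: "\<And>i x. i \<in> {1..n} \<Longrightarrow> x \<le> 2 * n \<Longrightarrow> 0 \<le> h i \<and> h i \<le> \<H> n i (t * (p n i / q n)) x (2 * n)"
  shows "(\<Prod>i=1..n. h i) \<le> heat_kernel (space n) (kern n) t x (top_state n)"
proof -
  have "(\<Prod>i=1..n. h i) \<le> (\<Prod>i=1..n. \<H> n i (t * (p n i / q n)) (x i) (2 * n))"
  proof (rule prod_mono)
    fix i assume i: "i \<in> {1..n}"
    then have "x i \<le> 2 * n"
      using product_space_component[OF x, of i] by simp
    then show "0 \<le> h i \<and> h i \<le> \<H> n i (t * (p n i / q n)) (x i) (2 * n)"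
      by (rule h[OF i])
  qed
  also have "\<dots> = heat_kernel (space n) (kern n) t x (top_state n)"
    unfolding heat_kernel_kern[OF n x top_bottom_in(1)] by (simp add: top_state_def)
  finally show ?thesis .
qed

lemma d_le:
  assumes "2 \<le> n" "0 \<le> t"
    and "\<And>i x. i \<in> {1..n} \<Longrightarrow> x \<le> 2 * n \<Longrightarrow> 0 \<le> h i \<and> h i \<le> \<H> n i (t * (p n i / q n)) x (2 * n)"
  shows "d n t \<le> 1 - (\<Prod>i=1..n. h i)"
  unfolding d_eq
  by (rule tv_dist_cont_le_one_minus[OF finite_space kern_stochastic kern_stationary top_bottom_in(1)])
     (use assms heat_kernel_top_ge in auto)

lemma stationary_top_ge:
  assumes "2 \<le> n"
    and "\<And>i x. i \<in> {1..n} \<Longrightarrow> x \<le> 2 * n \<Longrightarrow> 0 \<le> h i \<and> h i \<le> \<H> n i (t * (p n i / q n)) x (2 * n)"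
  shows "(\<Prod>i=1..n. h i) \<le> product_dist n (\<pi> n) (top_state n)"
  by (rule stationary_ge_heat_kernel[OF finite_space kern_stationary top_bottom_in(1), where t = t])
     (use assms heat_kernel_top_ge in auto)

text \<open>
  The bottom state, from which every coordinate has the longest way, is the starting point that shows slow mixing.
\<close>

lemma d_ge:
  assumes n: "2 \<le> n"
  shows "product_dist n (\<pi> n) (top_state n) - (\<Prod>i=1..n. \<H> n i (t * (p n i / q n)) 0 (2 * n)) \<le> d n t"
proof -
  have "(\<Prod>i=1..n. \<H> n i (t * (p n i / q n)) 0 (2 * n)) = heat_kernel (space n) (kern n) t (bottom_state n) (top_state n)"
    unfolding heat_kernel_kern[OF n top_bottom_in(2,1)] by (simp add: top_state_def bottom_state_def)
  then show ?thesis
    unfolding d_eq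
    using tv_dist_cont_ge_point[OF finite_space kern_stochastic kern_stationary top_bottom_in(2,1)] n
    by simp
qed

lemma d_le_1: "2 \<le> n \<Longrightarrow> 0 \<le> t \<Longrightarrow> d n t \<le> 1"
proof -
  assume n: "2 \<le> n" and t: "0 \<le> t"
  have "d n t \<le> 1 - (\<Prod>i=1..n. 0)"
  proof (rule d_le[OF n t])
    fix i x assume i: "i \<in> {1..n}" and x: "x \<le> 2 * n"
    have "0 \<le> t * (p n i / q n)"
      by (intro mult_nonneg_nonneg t weights n i)
    then show "0 \<le> (0::real) \<and> 0 \<le> \<H> n i (t * (p n i / q n)) x (2 * n)"
      using heat_nonneg[OF n i x] by simp
  qed
  then show ?thesis using n by (simp add: power_0_left)
qed

lemma finite_E_set: "finite (E_set p n \<delta>)" "E_set p n \<delta> \<subseteq> {1..n}"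
  by (auto simp: E_set_def)

lemma E_set_D: "i \<in> E_set p n \<delta> \<Longrightarrow> i \<in> {1..n}"
  by (simp add: E_set_def)

lemma E_set_0: "E_set p n 0 = {}"
proof -
  have "\<not> p n i < p_min p n" if "i \<in> {1..n}" for i
    using p_min_le[OF that] by simp
  then show ?thesis by (auto simp: E_set_def)
qed

lemma B_nonneg: "2 \<le> n \<Longrightarrow> 0 \<le> B_sum p b n \<delta>"
  unfolding B_sum_def by (intro sum_nonneg less_imp_le[OF b_pos] E_set_D)

lemma B_mono: "2 \<le> n \<Longrightarrow> \<delta> \<le> \<epsilon> \<Longrightarrow> B_sum p b n \<delta> \<le> B_sum p b n \<epsilon>"
proof -
  assume n: "2 \<le> n" and le: "\<delta> \<le> \<epsilon>"
  have "(1 + \<delta>) * p_min p n \<le> (1 + \<epsilon>) * p_min p n"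
    using p_min_pos[OF n] le by (intro mult_right_mono) auto
  then have "E_set p n \<delta> \<subseteq> E_set p n \<epsilon>"
    by (auto simp: E_set_def)
  then show ?thesis
    unfolding B_sum_def
    by (intro sum_mono2 finite_E_set less_imp_le[OF b_pos] n) (auto dest: E_set_D)
qed

lemma n_sum_a_tendsto_0: "(\<lambda>n. real n * (\<Sum>i=1..n. a n i)) \<longlonglongrightarrow> 0"
proof -
  have "(\<lambda>n. (\<Sum>i=1..n. a n i) / (1 / real n)) \<longlonglongrightarrow> 0"
    using sum_a by (rule smalloD_tendsto)
  then show ?thesis by (simp add: mult.commute)
qed

lemma chernoff_tendsto_0:
  assumes "0 < s" "s \<noteq> 1"
  shows "(\<lambda>n. chernoff_rate s ^ n) \<longlonglongrightarrow> 0" "(\<lambda>n. real n * chernoff_rate s ^ n) \<longlonglongrightarrow> 0"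
    "(\<lambda>n. chernoff_rate s ^ (2 * n)) \<longlonglongrightarrow> 0"
proof -
  have r: "0 < chernoff_rate s" "chernoff_rate s < 1"
    using chernoff_rate_less_1[OF assms] by auto
  show "(\<lambda>n. chernoff_rate s ^ n) \<longlonglongrightarrow> 0"
    using r by (intro LIMSEQ_power_zero) auto
  show "(\<lambda>n. real n * chernoff_rate s ^ n) \<longlonglongrightarrow> 0"
    using r by (intro powser_times_n_limit_0) auto
  have "(\<lambda>n. (chernoff_rate s ^ 2) ^ n) \<longlonglongrightarrow> 0"
    using r by (intro LIMSEQ_power_zero) (auto simp: abs_square_less_1)
  then show "(\<lambda>n. chernoff_rate s ^ (2 * n)) \<longlonglongrightarrow> 0"
    by (simp add: power_mult)
qed

text \<open>
  A bound for the sum, over all coordinates, of the probabilities of a Poisson tail or of a step in the wrong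
  direction.
\<close>

definition error :: "real \<Rightarrow> real \<Rightarrow> nat \<Rightarrow> real" where
  "error s r n = real n * chernoff_rate s ^ n + real n * chernoff_rate r ^ n
     + (2 * s + 4 * r) * (real n * (\<Sum>i=1..n. a n i))"

lemma error_tendsto_0:
  assumes "1 < s" "1 < r"
  shows "error s r \<longlonglongrightarrow> 0"
proof -
  have "(\<lambda>n. real n * chernoff_rate s ^ n + real n * chernoff_rate r ^ n
     + (2 * s + 4 * r) * (real n * (\<Sum>i=1..n. a n i))) \<longlonglongrightarrow> 0 + 0 + (2 * s + 4 * r) * 0"
    by (intro tendsto_add tendsto_mult tendsto_const chernoff_tendsto_0 n_sum_a_tendsto_0) (use assms in auto)
  then show ?thesis by (simp add: error_def[abs_def])
qed

lemma error_nonneg: "1 < s \<Longrightarrow> 1 < r \<Longrightarrow> 2 \<le> n \<Longrightarrow> 0 \<le> error s r n"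
  unfolding error_def using chernoff_rate_less_1[of s] chernoff_rate_less_1[of r] a_nonneg[of n]
  by (intro add_nonneg_nonneg mult_nonneg_nonneg sum_nonneg) auto

text \<open>
  By time \<open>s \<tau>\<close> every coordinate typically has made more than \<open>n\<close> steps and, as \<open>s * (1 + \<delta>) > 2\<close>, those outside
  \<open>E\<^sub>\<delta>\<close> more than \<open>2 * n\<close>.  Up to the factors \<open>g i\<close>, which take care of the untypical behaviour and whose product is close
  to one, only a coordinate in \<open>E\<^sub>\<delta>\<close> that has taken the detour can be missing from its top state.
\<close>

lemma coordinate_lower_bounds:
  assumes n: "2 \<le> n" and s: "1 < s" and \<delta>: "0 \<le> \<delta>" and r: "r = s * (1 + \<delta>) / 2" "1 < r"
  defines "\<beta> \<equiv> \<lambda>i. if i \<in> E_set p n \<delta> then 1 - b n i else 1"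
  obtains g where
    "\<And>i x. i \<in> {1..n} \<Longrightarrow> x \<le> 2 * n \<Longrightarrow> 0 \<le> \<beta> i * g i \<and> \<beta> i * g i \<le> \<H> n i (s * \<tau> n * (p n i / q n)) x (2 * n)"
    and "1 - error s r n \<le> (\<Prod>i=1..n. g i)"
proof
  \<comment> \<open>One error term serves both kinds of coordinates; truncation at \<open>0\<close> allows comparing products factor by factor.\<close>
  define g where "g i = max 0 (1 - (chernoff_rate s ^ n + chernoff_rate r ^ n + (2 * s + 4 * r) * (real n * a n i)))" for i
  have cs: "0 < chernoff_rate s" "chernoff_rate s < 1" and cr: "0 < chernoff_rate r" "chernoff_rate r < 1"
    using chernoff_rate_less_1[of s] chernoff_rate_less_1[of r] s r(2) by auto
  show "0 \<le> \<beta> i * g i \<and> \<beta> i * g i \<le> \<H> n i (s * \<tau> n * (p n i / q n)) x (2 * n)"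
    if i: "i \<in> {1..n}" and x: "x \<le> 2 * n" for i x
  proof -
    interpret detour_chain n "a n i" "b n i" "c n i" by (rule detour[OF n i])
    define u where "u = s * \<tau> n * (p n i / q n)"
    have u: "u = s * real n * (p n i / p_min p n)"
      unfolding u_def by (rule coordinate_time[OF n])
    have ge: "1 \<le> p n i / p_min p n"
      using p_min_le[OF i] p_min_pos[OF n] by simp
    have u_ge: "s * real n \<le> u"
      unfolding u using mult_left_mono[OF ge, of "s * real n"] s by simp
    have u0: "0 \<le> u"
      unfolding u_def by (rule coordinate_time_nonneg[OF n i]) (use s in simp)
    have \<beta>: "0 \<le> \<beta> i" "\<beta> i \<le> 1"
      using b_less[OF n i] b_pos[OF n i] by (auto simp: \<beta>_def)
    have g: "0 \<le> g i" by (simp add: g_def)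
    have sna: "0 \<le> s * (real n * a n i)" and rna: "0 \<le> r * (real n * a n i)"
      using a_nonneg[OF n i] s r(2) by auto
    have "\<beta> i * (1 - (chernoff_rate s ^ n + chernoff_rate r ^ n + (2 * s + 4 * r) * (real n * a n i))) \<le> H u x (2 * n)"
    proof (cases "i \<in> E_set p n \<delta>")
      case True
      have "2 * a n i * (s * real n) \<le> (2 * s + 4 * r) * (real n * a n i)"
        using rna by (simp add: algebra_simps)
      then have "\<beta> i * (1 - (chernoff_rate s ^ n + chernoff_rate r ^ n + (2 * s + 4 * r) * (real n * a n i)))
          \<le> (1 - b n i) * (1 - 2 * a n i * (s * real n) - chernoff_rate s ^ n)"
        using True \<beta> zero_less_power[OF cr(1), of n] unfolding \<beta>_def
        by (simp only: if_True) (intro mult_left_mono; linarith)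
      also have "\<dots> \<le> H u x (2 * n)"
        by (rule heat_top_ge_short[OF s u_ge]) (use x in simp)
      finally show ?thesis .
    next
      case False
      then have "1 + \<delta> \<le> p n i / p_min p n"
        using i p_min_pos[OF n] by (simp add: E_set_def pos_le_divide_eq)
      then have u_ge2: "r * (2 * real n) \<le> u"
      proof -
        have "s * (1 + \<delta>) / 2 * (2 * real n) = s * real n * (1 + \<delta>)" by simp
        also have "\<dots> \<le> s * real n * (p n i / p_min p n)"
          by (rule mult_left_mono) (use \<open>1 + \<delta> \<le> p n i / p_min p n\<close> s in auto)
        finally show ?thesis unfolding u r .
      qed
      have "2 * a n i * (r * (2 * real n)) \<le> (2 * s + 4 * r) * (real n * a n i)"
        using sna by (simp add: algebra_simps)
      moreover have "chernoff_rate r ^ (2 * n) \<le> chernoff_rate r ^ n"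
        using cr by (intro power_decreasing) auto
      ultimately have "1 - (chernoff_rate s ^ n + chernoff_rate r ^ n + (2 * s + 4 * r) * (real n * a n i))
          \<le> 1 - 2 * a n i * (r * (2 * real n)) - chernoff_rate r ^ (2 * n)"
        using zero_less_power[OF cs(1), of n] by linarith
      also have "\<dots> \<le> H u x (2 * n)"
        by (rule heat_top_ge_long[OF r(2) u_ge2]) (use x in simp)
      finally show ?thesis using False by (simp add: \<beta>_def)
    qed
    moreover have "0 \<le> H u x (2 * n)"
      by (rule heat_nonneg[OF n i x u0])
    ultimately have "\<beta> i * g i \<le> H u x (2 * n)"
      by (auto simp: g_def max_def)
    then show ?thesis
      unfolding u_def using \<beta> g by simp
  qed
  have g01: "0 \<le> g i \<and> g i \<le> 1" if "i \<in> {1..n}" for i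
  proof -
    have "0 \<le> chernoff_rate s ^ n + chernoff_rate r ^ n + (2 * s + 4 * r) * (real n * a n i)"
      using a_nonneg[OF n that] cs cr s r(2)
      by (intro add_nonneg_nonneg mult_nonneg_nonneg) auto
    then show ?thesis by (simp add: g_def)
  qed
  have "(\<Sum>i=1..n. 1 - g i) \<le> (\<Sum>i=1..n. chernoff_rate s ^ n + chernoff_rate r ^ n + (2 * s + 4 * r) * (real n * a n i))"
    by (rule sum_mono) (simp add: g_def)
  also have "\<dots> = error s r n"
    by (simp add: error_def sum.distrib sum_distrib_left algebra_simps)
  finally show "1 - error s r n \<le> (\<Prod>i=1..n. g i)"
    using prod_ge_one_minus_sum[of "{1..n}" g] g01 by simp
qed

text \<open>
  The detours in \<open>E\<^sub>\<delta>\<close> are all avoided with probability \<open>\<Prod>(1 - b\<^sub>i) \<ge> exp (- 2 * B\<^sub>\<delta>)\<close>, as \<open>b\<^sub>i \<le> 1 / 2\<close>.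
\<close>

lemma d_upper_bound:
  assumes n: "2 \<le> n" and s: "1 < s" and \<delta>: "0 \<le> \<delta>" and r: "r = s * (1 + \<delta>) / 2" "1 < r"
  shows "d n (s * \<tau> n) \<le> 1 - exp (- (2 * B_sum p b n \<delta>)) + error s r n"
proof -
  define \<beta> where "\<beta> i = (if i \<in> E_set p n \<delta> then 1 - b n i else 1)" for i
  obtain g where g: "\<And>i x. i \<in> {1..n} \<Longrightarrow> x \<le> 2 * n \<Longrightarrow>
      0 \<le> \<beta> i * g i \<and> \<beta> i * g i \<le> \<H> n i (s * \<tau> n * (p n i / q n)) x (2 * n)"
    and g_prod: "1 - error s r n \<le> (\<Prod>i=1..n. g i)"
    unfolding \<beta>_def by (rule coordinate_lower_bounds[OF assms]) blast
  have "d n (s * \<tau> n) \<le> 1 - (\<Prod>i=1..n. \<beta> i * g i)"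
    by (rule d_le[OF n _ g]) (use s \<tau>_pos[OF n] in auto)
  also have "(\<Prod>i=1..n. \<beta> i * g i) = (\<Prod>i\<in>E_set p n \<delta>. 1 - b n i) * (\<Prod>i=1..n. g i)"
  proof -
    have "(\<Prod>i=1..n. \<beta> i) = (\<Prod>i\<in>E_set p n \<delta>. 1 - b n i)"
      unfolding \<beta>_def
      using prod.inter_restrict[of "{1..n}" "\<lambda>i. 1 - b n i" "E_set p n \<delta>"] finite_E_set(2)[of n \<delta>]
      by (simp add: Int_absorb1)
    then show ?thesis by (simp add: prod.distrib)
  qed
  finally have d: "d n (s * \<tau> n) \<le> 1 - (\<Prod>i\<in>E_set p n \<delta>. 1 - b n i) * (\<Prod>i=1..n. g i)" .
  have b: "0 \<le> b n i" "b n i \<le> 1 / 2" if "i \<in> E_set p n \<delta>" for i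
    using b_pos[OF n E_set_D[OF that]] b_less[OF n E_set_D[OF that]] by auto
  let ?P = "\<Prod>i\<in>E_set p n \<delta>. 1 - b n i"
  have P: "0 \<le> ?P" "?P \<le> 1"
    by (intro prod_nonneg ballI, use b in fastforce) (intro prod_le_1, use b in fastforce)
  have "exp (- (2 * B_sum p b n \<delta>)) = (\<Prod>i\<in>E_set p n \<delta>. exp (- (2 * b n i)))"
    unfolding B_sum_def using finite_E_set by (simp add: sum_negf sum_distrib_left flip: exp_sum)
  also have "\<dots> \<le> ?P"
    using b by (intro prod_mono) (auto intro: exp_neg_twice_le)
  finally have "exp (- (2 * B_sum p b n \<delta>)) - error s r n \<le> ?P - ?P * error s r n"
    using mult_right_mono[OF P(2) error_nonneg[OF s r(2) n]] by simp
  also have "\<dots> = ?P * (1 - error s r n)"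
    by (simp add: algebra_simps)
  also have "\<dots> \<le> ?P * (\<Prod>i=1..n. g i)"
    using g_prod P by (intro mult_left_mono)
  finally show ?thesis using d by simp
qed

text \<open>
  At time \<open>3 \<tau>\<close> even a detour is completed, for \<open>E\<^sub>0\<close> is empty and \<open>3 > 2\<close>; so \<open>\<pi>\<close> concentrates on the top state.
\<close>

lemma stationary_top_bound:
  assumes n: "2 \<le> n"
  shows "1 - error 3 (3/2) n \<le> product_dist n (\<pi> n) (top_state n)"
proof -
  obtain g where g: "\<And>i x. i \<in> {1..n} \<Longrightarrow> x \<le> 2 * n \<Longrightarrow>
      0 \<le> (if i \<in> E_set p n 0 then 1 - b n i else 1) * g i \<and>
      (if i \<in> E_set p n 0 then 1 - b n i else 1) * g i \<le> \<H> n i (3 * \<tau> n * (p n i / q n)) x (2 * n)"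
    and g_prod: "1 - error 3 (3/2) n \<le> (\<Prod>i=1..n. g i)"
    by (rule coordinate_lower_bounds[of n 3 0 "3/2"]) (use n in auto)
  have "(\<Prod>i=1..n. g i) \<le> product_dist n (\<pi> n) (top_state n)"
    by (rule stationary_top_ge[OF n, where t = "3 * \<tau> n"]) (use g E_set_0 in auto)
  with g_prod show ?thesis by simp
qed

text \<open>Before time \<open>\<tau>\<close> the slowest coordinate typically has not even made \<open>n\<close> steps.\<close>

lemma d_before:
  assumes s: "0 < s" "s < 1"
  shows "(\<lambda>n. d n (s * \<tau> n)) \<longlonglongrightarrow> 1"
proof (rule tendsto_sandwich)
  show "\<forall>\<^sub>F n in sequentially. d n (s * \<tau> n) \<le> 1"
    using eventually_ge_at_top[of 2]
    by eventually_elim (use d_le_1 \<tau>_pos s in \<open>simp add: less_imp_le\<close>)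
  show "\<forall>\<^sub>F n in sequentially. 1 - error 3 (3/2) n - chernoff_rate s ^ n \<le> d n (s * \<tau> n)"
    using eventually_ge_at_top[of 2]
  proof eventually_elim
    case (elim n)
    obtain j where j: "j \<in> {1..n}" "p n j = p_min p n"
      by (rule p_min_attained[OF elim])
    interpret detour_chain n "a n j" "b n j" "c n j" by (rule detour[OF elim j(1)])
    let ?h = "\<lambda>i. \<H> n i (s * \<tau> n * (p n i / q n)) 0 (2 * n)"
    have t: "0 \<le> s * \<tau> n * (p n i / q n)" if "i \<in> {1..n}" for i
      using coordinate_time_nonneg[OF elim that] s by simp
    have h: "0 \<le> ?h i \<and> ?h i \<le> 1" if "i \<in> {1..n}" for i
      using heat_nonneg[OF elim that _ t[OF that], of 0] heat_le_1[OF elim that _ t[OF that], of 0] by simp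
    have "(\<Prod>i=1..n. ?h i) = ?h j * (\<Prod>i\<in>{1..n} - {j}. ?h i)"
      by (rule prod.remove) (use j in auto)
    also have "\<dots> \<le> ?h j * 1"
      by (intro mult_left_mono prod_le_1) (use h j(1) in blast)+
    also have "?h j \<le> chernoff_rate s ^ n"
    proof (rule heat_top_le_early[OF s t[OF j(1)]])
      show "s * \<tau> n * (p n j / q n) \<le> s * real n"
        using coordinate_time[OF elim, of s j] j(2) p_min_pos[OF elim] by simp
    qed
    finally show ?case
      using d_ge[OF elim, of "s * \<tau> n"] stationary_top_bound[OF elim] by simp
  qed
  have "(\<lambda>n. 1 - error 3 (3/2) n - chernoff_rate s ^ n) \<longlonglongrightarrow> 1 - 0 - 0"
    by (intro tendsto_diff tendsto_const error_tendsto_0 chernoff_tendsto_0) (use s in auto)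
  then show "(\<lambda>n. 1 - error 3 (3/2) n - chernoff_rate s ^ n) \<longlonglongrightarrow> 1" by simp
qed auto

text \<open>
  If \<open>s * (1 + \<delta>) < 2\<close>, a coordinate in \<open>E\<^sub>\<delta>\<close> that takes the detour typically has not completed it by time \<open>s \<tau>\<close>.
  The detours are independent, so the chance that none is under way is at most \<open>exp (- (B\<^sub>\<delta> / 2))\<close>; the factor \<open>1 / 2\<close>
  leaves room for the untypical behaviour.
\<close>

lemma d_lower_bound:
  assumes s: "1 < s" and \<delta>: "0 \<le> \<delta>" "s * (1 + \<delta>) < 2"
  shows "\<forall>\<^sub>F n in sequentially. 1 - exp (- (B_sum p b n \<delta> / 2)) - error 3 (3/2) n \<le> d n (s * \<tau> n)"
proof -
  define r where "r = s * (1 + \<delta>) / 2"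
  have r: "0 < r" "r < 1" using assms by (auto simp: r_def)
  define \<kappa> where "\<kappa> n = (1 - 2 * (real n * (\<Sum>i=1..n. a n i))) * (1 - chernoff_rate s ^ n - chernoff_rate r ^ (2 * n))" for n
  have "\<kappa> \<longlonglongrightarrow> (1 - 2 * 0) * (1 - 0 - 0)"
    unfolding \<kappa>_def[abs_def]
    by (intro tendsto_mult tendsto_diff tendsto_const n_sum_a_tendsto_0 chernoff_tendsto_0) (use s r in auto)
  \<comment> \<open>\<open>\<kappa> n\<close> bounds from below the ratio of the probability that a detour is under way to \<open>b\<^sub>i\<close>.\<close>
  then have "\<forall>\<^sub>F n in sequentially. 1 / 2 < \<kappa> n"
    by (rule order_tendstoD) simp
  moreover have "\<forall>\<^sub>F n in sequentially. real n * (\<Sum>i=1..n. a n i) < 1 / 2"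
    using n_sum_a_tendsto_0 by (rule order_tendstoD) simp
  ultimately show ?thesis
    using eventually_ge_at_top[of 2]
  proof eventually_elim
    case (elim n)
    note n = elim(3)
    let ?u = "\<lambda>i. s * \<tau> n * (p n i / q n)"
    let ?h = "\<lambda>i. \<H> n i (?u i) 0 (2 * n)"
    have t: "0 \<le> ?u i" if "i \<in> {1..n}" for i
      using coordinate_time_nonneg[OF n that] s by simp
    have h: "0 \<le> ?h i \<and> ?h i \<le> 1" if "i \<in> {1..n}" for i
      using heat_nonneg[OF n that _ t[OF that], of 0] heat_le_1[OF n that _ t[OF that], of 0] by simp
    have E: "?h i \<le> exp (- (b n i / 2))" if "i \<in> E_set p n \<delta>" for i
    proof -
      have i: "i \<in> {1..n}" using that by (simp add: E_set_def)
      interpret detour_chain n "a n i" "b n i" "c n i" by (rule detour[OF n i])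
      have u: "?u i = s * real n * (p n i / p_min p n)"
        by (rule coordinate_time[OF n])
      have ge: "1 \<le> p n i / p_min p n"
        using p_min_le[OF i] p_min_pos[OF n] by simp
      have le: "p n i / p_min p n \<le> 1 + \<delta>"
        using that p_min_pos[OF n] by (simp add: E_set_def pos_divide_le_eq)
      have u_ge: "s * real n \<le> ?u i"
        unfolding u using mult_left_mono[OF ge, of "s * real n"] s by simp
      have u_le: "?u i \<le> r * (2 * real n)"
      proof -
        have "s * real n * (p n i / p_min p n) \<le> s * real n * (1 + \<delta>)"
          by (rule mult_left_mono[OF le]) (use s in simp)
        also have "\<dots> = r * (2 * real n)" by (simp add: r_def)
        finally show ?thesis unfolding u .
      qed
      have a_le: "real n * a n i \<le> real n * (\<Sum>i=1..n. a n i)"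
        by (intro mult_left_mono member_le_sum) (use i a_nonneg[OF n] in auto)
      have factor: "0 \<le> 1 - chernoff_rate s ^ n - chernoff_rate r ^ (2 * n)"
      proof (rule ccontr)
        assume "\<not> ?thesis"
        then have "\<kappa> n \<le> 0"
          unfolding \<kappa>_def using elim(2) by (intro mult_nonneg_nonpos) auto
        then show False using elim(1) by simp
      qed
      have "\<kappa> n \<le> (1 - 2 * real n * a n i) * (1 - chernoff_rate s ^ n - chernoff_rate r ^ (2 * n))"
        unfolding \<kappa>_def using a_le factor by (intro mult_right_mono) auto
      then have "b n i * (1 / 2) \<le> b n i * ((1 - 2 * real n * a n i) * (1 - chernoff_rate s ^ n - chernoff_rate r ^ (2 * n)))"
        using elim(1) b_pos[OF n i] by (intro mult_left_mono) auto
      moreover have "?h i \<le> 1 - b n i * ((1 - 2 * real n * a n i) * (1 - chernoff_rate s ^ n - chernoff_rate r ^ (2 * n)))"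
        by (rule heat_top_le_detour[OF s u_ge r u_le]) (use a_le elim(2) in auto)
      ultimately have "?h i \<le> 1 + (- (b n i / 2))" by simp
      also have "\<dots> \<le> exp (- (b n i / 2))" by (rule exp_ge_add_one_self)
      finally show ?thesis .
    qed
    have "(\<Prod>i=1..n. ?h i) = (\<Prod>i\<in>{1..n} - E_set p n \<delta>. ?h i) * (\<Prod>i\<in>E_set p n \<delta>. ?h i)"
      by (rule prod.subset_diff) (use finite_E_set in auto)
    also have "\<dots> \<le> 1 * (\<Prod>i\<in>E_set p n \<delta>. exp (- (b n i / 2)))"
    proof -
      have "0 \<le> ?h i" if "i \<in> E_set p n \<delta>" for i
        using h[OF E_set_D[OF that]] by blast
      then show ?thesis
        by (intro mult_mono prod_mono prod_le_1 prod_nonneg) (use h E in auto)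
    qed
    also have "\<dots> = exp (- (B_sum p b n \<delta> / 2))"
      unfolding B_sum_def using finite_E_set by (simp add: sum_negf sum_divide_distrib flip: exp_sum)
    finally show ?case
      using d_ge[OF n, of "s * \<tau> n"] stationary_top_bound[OF n] by simp
  qed
qed

end

section \<open>Critical values\<close>

lemma Delta_zero_ge_0: "0 \<le> Delta_zero F"
proof (cases "{\<delta> \<in> {0<..<1}. F \<delta> = 0} = {}")
  case False
  then obtain \<delta> where \<delta>: "0 < \<delta>" "\<delta> < 1" "F \<delta> = 0" by auto
  have "\<delta> \<le> Sup {\<delta> \<in> {0<..<1}. F \<delta> = 0}"
    by (rule cSup_upper) (use \<delta> in \<open>auto intro!: bdd_aboveI[where M = 1]\<close>)
  with \<delta> False show ?thesis by (simp add: Delta_zero_def)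
qed (simp only: Delta_zero_def Let_def simp_thms if_True order_refl)

lemma le_Delta_zero:
  assumes "0 < \<delta>" "\<delta> < 1" "F \<delta> = 0"
  shows "\<delta> \<le> Delta_zero F"
proof -
  have "\<delta> \<le> Sup {\<delta> \<in> {0<..<1}. F \<delta> = 0}"
    by (rule cSup_upper) (use assms in \<open>auto intro!: bdd_aboveI[where M = 1]\<close>)
  moreover have "{\<delta> \<in> {0<..<1}. F \<delta> = 0} \<noteq> {}" using assms by auto
  ultimately show ?thesis by (simp only: Delta_zero_def Let_def if_False)
qed

lemma Delta_inf_le:
  assumes "0 < \<delta>" "\<delta> < 1" "F \<delta> = \<infinity>"
  shows "Delta_inf F \<le> \<delta>"
proof -
  have "Inf {\<delta> \<in> {0<..<1}. F \<delta> = \<infinity>} \<le> \<delta>"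
    by (rule cInf_lower) (use assms in \<open>auto intro!: bdd_belowI[where m = 0]\<close>)
  moreover have "{\<delta> \<in> {0<..<1}. F \<delta> = \<infinity>} \<noteq> {}" using assms by auto
  ultimately show ?thesis by (simp only: Delta_inf_def Let_def if_False)
qed

lemma Delta_zero_lessD:
  assumes "x < Delta_zero F" "0 \<le> x"
  obtains \<delta> where "\<delta> \<in> {0<..<1}" "F \<delta> = 0" "x < \<delta>"
proof -
  let ?D = "{\<delta> \<in> {0<..<1}. F \<delta> = 0}"
  have ne: "?D \<noteq> {}"
  proof
    assume "?D = {}"
    then have "Delta_zero F = 0" by (simp only: Delta_zero_def Let_def simp_thms if_True)
    with assms show False by simp
  qed
  then have "x < Sup ?D" using assms by (simp only: Delta_zero_def Let_def if_False)
  then obtain \<delta> where "\<delta> \<in> ?D" "x < \<delta>" by (rule less_cSupE) (rule ne)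
  then show ?thesis using that by blast
qed

lemma Delta_inf_lessD:
  assumes "Delta_inf F < x" "x \<le> 1"
  obtains \<delta> where "\<delta> \<in> {0<..<1}" "F \<delta> = \<infinity>" "\<delta> < x"
proof -
  let ?D = "{\<delta> \<in> {0<..<1}. F \<delta> = \<infinity>}"
  have ne: "?D \<noteq> {}"
  proof
    assume "?D = {}"
    then have "Delta_inf F = 1" by (simp only: Delta_inf_def Let_def simp_thms if_True)
    with assms show False by simp
  qed
  then have "Inf ?D < x" using assms by (simp only: Delta_inf_def Let_def if_False)
  then obtain \<delta> where "\<delta> \<in> ?D" "\<delta> < x" using cInf_lessD[OF ne] by blast
  then show ?thesis using that by blast
qed

text \<open>
  The two critical values of a nonnegative increasing function fail to be separated precisely if it jumps from \<open>0\<close> to \<open>\<infinity>\<close> at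
  one point \<open>D\<close>.  Here \<open>D = 0\<close> and \<open>D = 1\<close>, where one of the two conditions is void, correspond to the conventions
  for the empty set.
\<close>

lemma Delta_not_less_if_jump:
  assumes D: "0 \<le> D" "D \<le> 1"
    and zero: "\<And>\<delta>. \<delta> \<in> {0<..<1} \<Longrightarrow> \<delta> < D \<Longrightarrow> F \<delta> = 0"
    and inf: "\<And>\<delta>. \<delta> \<in> {0<..<1} \<Longrightarrow> D < \<delta> \<Longrightarrow> F \<delta> = \<infinity>"
  shows "\<not> Delta_zero F < Delta_inf F"
proof
  assume less: "Delta_zero F < Delta_inf F"
  have "Delta_inf F \<le> 1"
  proof (rule ccontr)
    assume "\<not> Delta_inf F \<le> 1"
    then have "1 < Delta_inf F" by simp
    then have "{\<delta> \<in> {0<..<1}. F \<delta> = \<infinity>} \<noteq> {}"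
      by (auto simp: Delta_inf_def Let_def split: if_splits)
    then obtain \<delta> where "0 < \<delta>" "\<delta> < 1" "F \<delta> = \<infinity>" by auto
    then show False
      using Delta_inf_le[of \<delta> F] \<open>1 < Delta_inf F\<close> by simp
  qed
  consider "D < Delta_inf F" | "Delta_zero F < D" using less by linarith
  then show False
  proof cases
    case 1
    then obtain \<delta> where \<delta>: "D < \<delta>" "\<delta> < Delta_inf F" using dense by blast
    then have "Delta_inf F \<le> \<delta>"
      using D \<open>Delta_inf F \<le> 1\<close> by (intro Delta_inf_le inf) auto
    with \<delta> show False by simp
  next
    case 2
    then obtain \<delta> where \<delta>: "Delta_zero F < \<delta>" "\<delta> < D" using dense by blast
    then have "\<delta> \<le> Delta_zero F"
      using D Delta_zero_ge_0[of F] by (intro le_Delta_zero zero) auto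
    with \<delta> show False by simp
  qed
qed

lemma jump_if_Delta_not_less:
  assumes nl: "\<not> Delta_zero F < Delta_inf F"
    and mono: "\<And>\<delta> \<epsilon>. \<delta> \<le> \<epsilon> \<Longrightarrow> F \<delta> \<le> F \<epsilon>" and nonneg: "\<And>\<delta>. 0 \<le> F \<delta>"
  shows "\<exists>D. 0 \<le> D \<and> D \<le> 1 \<and> (\<forall>\<delta>\<in>{0<..<1}. (\<delta> < D \<longrightarrow> F \<delta> = 0) \<and> (D < \<delta> \<longrightarrow> F \<delta> = \<infinity>))"
proof (intro exI[of _ "Delta_zero F"] conjI ballI impI)
  show "0 \<le> Delta_zero F" by (rule Delta_zero_ge_0)
  show "Delta_zero F \<le> 1"
  proof (rule ccontr)
    assume "\<not> Delta_zero F \<le> 1"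
    then have "1 < Delta_zero F" by simp
    then obtain \<delta> where "\<delta> \<in> {0<..<1}" "F \<delta> = 0" "1 < \<delta>" by (rule Delta_zero_lessD) auto
    then show False by simp
  qed
  show "F \<delta> = 0" if \<delta>: "\<delta> \<in> {0<..<1}" "\<delta> < Delta_zero F" for \<delta>
  proof -
    obtain \<epsilon> where "F \<epsilon> = 0" "\<delta> < \<epsilon>"
      by (rule Delta_zero_lessD[OF \<delta>(2)]) (use \<delta> in auto)
    then show ?thesis using mono[of \<delta> \<epsilon>] nonneg[of \<delta>] by simp
  qed
  show "F \<delta> = \<infinity>" if \<delta>: "\<delta> \<in> {0<..<1}" "Delta_zero F < \<delta>" for \<delta>
  proof -
    have "Delta_inf F < \<delta>" using nl \<delta> by simp
    then obtain \<epsilon> where "F \<epsilon> = \<infinity>" "\<epsilon> < \<delta>"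
      by (rule Delta_inf_lessD) (use \<delta> in auto)
    then show ?thesis using mono[of \<epsilon> \<delta>] by simp
  qed
qed

lemma diagonal_subsequence:
  fixes P :: "nat \<Rightarrow> nat \<Rightarrow> bool"
  assumes "\<And>j. \<exists>\<^sub>F k in sequentially. P j k"
  obtains f where "strict_mono f" "\<And>j. P j (f j)"
proof -
  have "\<exists>f. \<forall>j. P j (f j) \<and> f j < f (Suc j)"
  proof (rule dependent_nat_choice)
    show "\<exists>k. P 0 k"
      using assms[of 0] by (auto simp: frequently_sequentially)
    show "\<exists>k'. P (Suc j) k' \<and> k < k'" for j k
      using assms[of "Suc j"] unfolding frequently_sequentially by (metis Suc_le_eq)
  qed
  then show ?thesis using that by (auto simp: strict_mono_Suc_iff)
qed

section \<open>Thresholds and cutoff\<close>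

context detour_family
begin

abbreviation B :: "nat \<Rightarrow> real \<Rightarrow> real" where "B \<equiv> B_sum p b"

text \<open>
  \<open>B\<^sub>\<delta>\<close> is roughly the expected number of coordinates in \<open>E\<^sub>\<delta>\<close> that take the detour.  Along a sequence with
  threshold \<open>D\<close> it passes from \<open>0\<close> to \<open>\<infinity>\<close> at \<open>\<delta> = D\<close>; as detours in \<open>E\<^sub>\<delta>\<close> are completed at times between \<open>2 / (1 + \<delta>) * \<tau>\<close> and
  \<open>2 \<tau>\<close>, this corresponds to the time \<open>2 / (1 + D) * \<tau>\<close>.
\<close>

definition threshold :: "(nat \<Rightarrow> nat) \<Rightarrow> real \<Rightarrow> bool" where
  "threshold \<xi> D \<longleftrightarrow> (\<forall>\<delta>\<in>{0<..<1}.
     (\<delta> < D \<longrightarrow> (\<lambda>k. B (\<xi> k) \<delta>) \<longlonglongrightarrow> 0) \<and> (D < \<delta> \<longrightarrow> (LIM k sequentially. B (\<xi> k) \<delta> :> at_top)))"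

lemma threshold_subseq:
  assumes "threshold \<xi> D" "strict_mono f"
  shows "threshold (\<xi> \<circ> f) D"
proof -
  have "filterlim (\<lambda>k. B (\<xi> (f k)) \<delta>) L sequentially" if "filterlim (\<lambda>k. B (\<xi> k) \<delta>) L sequentially" for \<delta> L
    using that filterlim_subseq[OF assms(2)] by (rule filterlim_compose)
  then show ?thesis
    using assms(1) by (simp add: threshold_def)
qed

lemma eventually_ge_2:
  assumes "strict_mono (\<xi> :: nat \<Rightarrow> nat)"
  shows "\<forall>\<^sub>F k in sequentially. 2 \<le> \<xi> k"
  using filterlim_subseq[OF assms] eventually_ge_at_top[of 2] by (rule eventually_compose_filterlim[rotated])

lemma d_before_subseq:
  assumes "strict_mono \<xi>" "0 < s" "s < 1"
  shows "(\<lambda>k. d (\<xi> k) (s * \<tau> (\<xi> k))) \<longlonglongrightarrow> 1"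
  using d_before[OF assms(2,3)] filterlim_subseq[OF assms(1)] by (rule filterlim_compose)

lemma error_subseq:
  assumes "strict_mono \<xi>" "1 < s" "1 < r"
  shows "(\<lambda>k. error s r (\<xi> k)) \<longlonglongrightarrow> 0"
  using error_tendsto_0[OF assms(2,3)] filterlim_subseq[OF assms(1)] by (rule filterlim_compose)

lemma d_upper_subseq:
  assumes \<xi>: "strict_mono \<xi>" and s: "1 < s" "0 \<le> \<delta>" "2 < s * (1 + \<delta>)"
  shows "\<forall>\<^sub>F k in sequentially. d (\<xi> k) (s * \<tau> (\<xi> k)) \<le> 1 - exp (- (2 * B (\<xi> k) \<delta>)) + error s (s * (1 + \<delta>) / 2) (\<xi> k)"
  using eventually_ge_2[OF \<xi>] by eventually_elim (rule d_upper_bound, use s in auto)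

lemma d_lower_subseq:
  assumes \<xi>: "strict_mono \<xi>" and s: "1 < s" "0 \<le> \<delta>" "s * (1 + \<delta>) < 2"
  shows "\<forall>\<^sub>F k in sequentially. 1 - exp (- (B (\<xi> k) \<delta> / 2)) - error 3 (3/2) (\<xi> k) \<le> d (\<xi> k) (s * \<tau> (\<xi> k))"
  using filterlim_subseq[OF \<xi>] d_lower_bound[OF s] by (rule eventually_compose_filterlim[rotated])

lemma d_le_1_subseq:
  assumes "strict_mono \<xi>" "0 \<le> s"
  shows "\<forall>\<^sub>F k in sequentially. d (\<xi> k) (s * \<tau> (\<xi> k)) \<le> 1"
  using eventually_ge_2[OF assms(1)]
  by eventually_elim (rule d_le_1, use assms(2) \<tau>_pos in \<open>auto simp: less_imp_le\<close>)

lemma d_tendsto_0_if: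
  assumes \<xi>: "strict_mono \<xi>" and s: "1 < s" "0 \<le> \<delta>" "2 < s * (1 + \<delta>)"
    and B: "(\<lambda>k. B (\<xi> k) \<delta>) \<longlonglongrightarrow> 0"
  shows "(\<lambda>k. d (\<xi> k) (s * \<tau> (\<xi> k))) \<longlonglongrightarrow> 0"
proof (rule tendsto_sandwich[OF _ d_upper_subseq[OF \<xi> s] tendsto_const])
  have "(\<lambda>k. 1 - exp (- (2 * B (\<xi> k) \<delta>)) + error s (s * (1 + \<delta>) / 2) (\<xi> k)) \<longlonglongrightarrow> 1 - exp (- (2 * 0)) + 0"
    by (intro tendsto_intros B error_subseq \<xi>) (use s in auto)
  then show "(\<lambda>k. 1 - exp (- (2 * B (\<xi> k) \<delta>)) + error s (s * (1 + \<delta>) / 2) (\<xi> k)) \<longlonglongrightarrow> 0" by simp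
qed (intro always_eventually allI d_nonneg)

lemma d_tendsto_1_if:
  assumes \<xi>: "strict_mono \<xi>" and s: "1 < s" "0 \<le> \<delta>" "s * (1 + \<delta>) < 2"
    and B: "LIM k sequentially. B (\<xi> k) \<delta> :> at_top"
  shows "(\<lambda>k. d (\<xi> k) (s * \<tau> (\<xi> k))) \<longlonglongrightarrow> 1"
proof (rule tendsto_sandwich[OF d_lower_subseq[OF \<xi> s] d_le_1_subseq[OF \<xi>]])
  have "LIM k sequentially. 1 / 2 * B (\<xi> k) \<delta> :> at_top"
    by (rule filterlim_tendsto_pos_mult_at_top[OF tendsto_const _ B]) simp
  then have "LIM k sequentially. - (B (\<xi> k) \<delta> / 2) :> at_bot"
    by (simp add: filterlim_uminus_at_bot)
  then have "(\<lambda>k. exp (- (B (\<xi> k) \<delta> / 2))) \<longlonglongrightarrow> 0"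
    by (rule filterlim_compose[OF exp_at_bot])
  then have "(\<lambda>k. 1 - exp (- (B (\<xi> k) \<delta> / 2)) - error 3 (3/2) (\<xi> k)) \<longlonglongrightarrow> 1 - 0 - 0"
    by (intro tendsto_intros error_subseq \<xi>) auto
  then show "(\<lambda>k. 1 - exp (- (B (\<xi> k) \<delta> / 2)) - error 3 (3/2) (\<xi> k)) \<longlonglongrightarrow> 1" by simp
qed (use s in auto)

lemma B_tendsto_0_if:
  assumes \<xi>: "strict_mono \<xi>" and s: "1 < s" "0 \<le> \<delta>" "s * (1 + \<delta>) < 2"
    and d: "(\<lambda>k. d (\<xi> k) (s * \<tau> (\<xi> k))) \<longlonglongrightarrow> 0"
  shows "(\<lambda>k. B (\<xi> k) \<delta>) \<longlonglongrightarrow> 0"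
proof -
  define y where "y k = 1 - d (\<xi> k) (s * \<tau> (\<xi> k)) - error 3 (3/2) (\<xi> k)" for k
  have "y \<longlonglongrightarrow> 1 - 0 - 0"
    unfolding y_def[abs_def] by (intro tendsto_intros d error_subseq \<xi>) auto
  then have y: "y \<longlonglongrightarrow> 1" by simp
  show ?thesis
  proof (rule tendsto_sandwich)
    show "\<forall>\<^sub>F k in sequentially. 0 \<le> B (\<xi> k) \<delta>"
      using eventually_ge_2[OF \<xi>] by eventually_elim (rule B_nonneg)
    have "\<forall>\<^sub>F k in sequentially. 0 < y k"
      using y by (rule order_tendstoD) simp
    then show "\<forall>\<^sub>F k in sequentially. B (\<xi> k) \<delta> \<le> - 2 * ln (y k)"
      using d_lower_subseq[OF \<xi> s]
    proof eventually_elim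
      case (elim k)
      then have "y k \<le> exp (- (B (\<xi> k) \<delta> / 2))" by (simp add: y_def)
      then have "ln (y k) \<le> ln (exp (- (B (\<xi> k) \<delta> / 2)))" using elim(1) by (intro ln_mono) auto
      then show ?case by simp
    qed
    have "(\<lambda>k. - 2 * ln (y k)) \<longlonglongrightarrow> - 2 * ln 1"
      by (intro tendsto_intros y) auto
    then show "(\<lambda>k. - 2 * ln (y k)) \<longlonglongrightarrow> 0" by simp
  qed auto
qed

lemma B_at_top_if:
  assumes \<xi>: "strict_mono \<xi>" and s: "1 < s" "0 \<le> \<delta>" "2 < s * (1 + \<delta>)"
    and d: "(\<lambda>k. d (\<xi> k) (s * \<tau> (\<xi> k))) \<longlonglongrightarrow> 1"
  shows "LIM k sequentially. B (\<xi> k) \<delta> :> at_top"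
  unfolding filterlim_at_top
proof
  fix Z
  define y where "y k = 1 - d (\<xi> k) (s * \<tau> (\<xi> k)) + error s (s * (1 + \<delta>) / 2) (\<xi> k)" for k
  have "y \<longlonglongrightarrow> 1 - 1 + 0"
    unfolding y_def[abs_def] by (intro tendsto_intros d error_subseq \<xi>) (use s in auto)
  then have "\<forall>\<^sub>F k in sequentially. y k < exp (- (2 * Z))"
    by (rule order_tendstoD) simp
  then show "\<forall>\<^sub>F k in sequentially. Z \<le> B (\<xi> k) \<delta>"
    using d_upper_subseq[OF \<xi> s]
  proof eventually_elim
    case (elim k)
    then have "exp (- (2 * B (\<xi> k) \<delta>)) < exp (- (2 * Z))" unfolding y_def by linarith
    then show ?case by simp
  qed
qed

text \<open>
  After time \<open>2 / (1 + D) * \<tau>\<close> some \<open>\<delta> < D\<close>, or \<open>\<delta> = 0\<close>, satisfies \<open>s * (1 + \<delta>) > 2\<close>, and \<open>B\<^sub>\<delta>\<close> vanishes; before that time some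
  \<open>\<delta> > D\<close> satisfies \<open>s * (1 + \<delta>) < 2\<close>, and \<open>B\<^sub>\<delta>\<close> explodes.
\<close>

lemma cutoff_if_threshold:
  assumes \<xi>: "strict_mono \<xi>" "\<And>k. 2 \<le> \<xi> k" and D: "0 \<le> D" "D \<le> 1" and th: "threshold \<xi> D"
  shows "has_tv_cutoff d \<xi>"
proof -
  define r where "r = 2 / (1 + D)"
  have r: "r * (1 + D) = 2" "1 \<le> r" "0 < r"
    using D by (auto simp: r_def field_simps)
  have after: "(\<lambda>k. d (\<xi> k) (s * \<tau> (\<xi> k))) \<longlonglongrightarrow> 0" if s: "r < s" for s
  proof -
    have s1: "1 < s" "2 < s * (1 + D)"
      using s r D mult_strict_right_mono[OF s, of "1 + D"] by auto
    show ?thesis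
    proof (cases "D = 0")
      case True
      show ?thesis
        by (rule d_tendsto_0_if[OF \<xi>(1), of s 0])
           (use s1 True in \<open>auto simp: B_sum_def E_set_0\<close>)
    next
      case False
      define \<delta> where "\<delta> = max (D / 2) ((D + (2 / s - 1)) / 2)"
      have \<delta>: "0 < \<delta>" "\<delta> < D"
        using s1 D False by (auto simp: \<delta>_def field_simps)
      have "2 / s - 1 < D"
        using s1 by (simp add: field_simps)
      then have "2 / s - 1 < \<delta>" by (simp add: \<delta>_def less_max_iff_disj)
      then have "2 < s * (1 + \<delta>)"
        using s1 by (simp add: field_simps)
      then show ?thesis
        using \<delta> th D s1 by (intro d_tendsto_0_if[OF \<xi>(1), of s \<delta>]) (auto simp: threshold_def)
    qed
  qed
  have before: "(\<lambda>k. d (\<xi> k) (s * \<tau> (\<xi> k))) \<longlonglongrightarrow> 1" if s: "0 < s" "s < r" for s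
  proof (cases "s < 1")
    case True
    then show ?thesis using d_before_subseq \<xi> s by blast
  next
    case False
    \<comment> \<open>The estimates exclude \<open>s = 1\<close>, so the limit is first taken at a slightly later time.\<close>
    define s' where "s' = (s + r) / 2"
    have s': "1 < s'" "s \<le> s'" "s' < r" using s False by (auto simp: s'_def)
    have "s' * (1 + D) < 2"
      using mult_strict_right_mono[OF s'(3), of "1 + D"] r D by simp
    define \<delta> where "\<delta> = (D + (2 / s' - 1)) / 2"
    have gt: "D < 2 / s' - 1"
      using \<open>s' * (1 + D) < 2\<close> s' by (simp add: field_simps)
    moreover have "2 / s' - 1 < 1"
      using s' by (simp add: field_simps)
    ultimately have \<delta>: "D < \<delta>" "\<delta> < 1" "\<delta> < 2 / s' - 1" by (auto simp: \<delta>_def)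
    have "s' * (1 + \<delta>) < 2"
      using \<delta>(3) s' by (simp add: field_simps)
    then have lim: "(\<lambda>k. d (\<xi> k) (s' * \<tau> (\<xi> k))) \<longlonglongrightarrow> 1"
      using \<delta> th D s' by (intro d_tendsto_1_if[OF \<xi>(1), of s' \<delta>]) (auto simp: threshold_def)
    show ?thesis
    proof (rule tendsto_sandwich[OF _ d_le_1_subseq[OF \<xi>(1)] lim])
      have "d (\<xi> k) (s' * \<tau> (\<xi> k)) \<le> d (\<xi> k) (s * \<tau> (\<xi> k))" for k
        using s s' \<tau>_pos[OF \<xi>(2), of k]
        by (intro d_antimono \<xi>(2) mult_right_mono) auto
      then show "\<forall>\<^sub>F k in sequentially. d (\<xi> k) (s' * \<tau> (\<xi> k)) \<le> d (\<xi> k) (s * \<tau> (\<xi> k))"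
        by simp
    qed (use s in auto)
  qed
  show ?thesis
    unfolding has_tv_cutoff_def
  proof (intro exI[of _ "\<lambda>k. r * \<tau> (\<xi> k)"] conjI allI ballI impI)
    show "0 < r * \<tau> (\<xi> k)" for k
      using r \<tau>_pos[OF \<xi>(2)] by simp
  next
    fix \<alpha> :: real assume "1 < \<alpha>"
    then show "(\<lambda>k. d (\<xi> k) (\<alpha> * (r * \<tau> (\<xi> k)))) \<longlonglongrightarrow> 0"
      using after[of "\<alpha> * r"] r by (simp add: mult.assoc)
  next
    fix \<alpha> :: real assume "\<alpha> \<in> {0<..<1}"
    then show "(\<lambda>k. d (\<xi> k) (\<alpha> * (r * \<tau> (\<xi> k)))) \<longlonglongrightarrow> 1"
      using before[of "\<alpha> * r"] r by (simp add: mult.assoc)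
  qed
qed

text \<open>
  The cutoff times are comparable with \<open>\<tau>\<close>, as the distance drops from \<open>1\<close> to \<open>0\<close> between \<open>\<tau> / 2\<close> and
  \<open>5/2 * \<tau>\<close>; along a subsequence their ratio converges to some \<open>\<rho>\<close>, and the cutoff then sits at \<open>\<rho> \<tau>\<close>.
\<close>

lemma cutoff_ratio:
  assumes \<xi>: "strict_mono \<xi>" "\<And>k. 2 \<le> \<xi> k" and cut: "has_tv_cutoff d \<xi>"
  obtains f \<rho> where "strict_mono f" "0 < \<rho>"
    "\<And>s. 0 < s \<Longrightarrow> s < \<rho> \<Longrightarrow> (\<lambda>k. d (\<xi> (f k)) (s * \<tau> (\<xi> (f k)))) \<longlonglongrightarrow> 1"
    "\<And>s. \<rho> < s \<Longrightarrow> (\<lambda>k. d (\<xi> (f k)) (s * \<tau> (\<xi> (f k)))) \<longlonglongrightarrow> 0"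
proof -
  obtain t where t: "\<And>k. 0 < t k"
    and t0: "\<And>\<alpha>. 1 < \<alpha> \<Longrightarrow> (\<lambda>k. d (\<xi> k) (\<alpha> * t k)) \<longlonglongrightarrow> 0"
    and t1: "\<And>\<alpha>. 0 < \<alpha> \<Longrightarrow> \<alpha> < 1 \<Longrightarrow> (\<lambda>k. d (\<xi> k) (\<alpha> * t k)) \<longlonglongrightarrow> 1"
  proof -
    obtain t where "(\<forall>k. 0 < t k) \<and> (\<forall>\<alpha>>1. (\<lambda>k. d (\<xi> k) (\<alpha> * t k)) \<longlonglongrightarrow> 0) \<and>
        (\<forall>\<alpha>\<in>{0<..<1}. (\<lambda>k. d (\<xi> k) (\<alpha> * t k)) \<longlonglongrightarrow> 1)"
      using cut unfolding has_tv_cutoff_def by blast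
    then show ?thesis by (intro that[of t]) simp_all
  qed
  have \<tau>: "0 < \<tau> (\<xi> k)" for k by (rule \<tau>_pos[OF \<xi>(2)])
  define R where "R k = t k / \<tau> (\<xi> k)" for k
  have tR: "t k = R k * \<tau> (\<xi> k)" for k using \<tau>[of k] by (simp add: R_def)
  have R0: "0 < R k" for k using t \<tau> by (simp add: R_def)
  have order: "u * \<tau> (\<xi> k) < \<alpha> * t k" if "d (\<xi> k) (\<alpha> * t k) < d (\<xi> k) (u * \<tau> (\<xi> k))" "0 < \<alpha>" for u \<alpha> k
  proof (rule ccontr)
    assume "\<not> ?thesis"
    then have "d (\<xi> k) (u * \<tau> (\<xi> k)) \<le> d (\<xi> k) (\<alpha> * t k)"
      using that(2) t[of k] \<xi>(2) by (intro d_antimono) auto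
    with that show False by simp
  qed
  have order': "\<alpha> * t k < u * \<tau> (\<xi> k)" if "d (\<xi> k) (u * \<tau> (\<xi> k)) < d (\<xi> k) (\<alpha> * t k)" "0 < u" for u \<alpha> k
  proof (rule ccontr)
    assume "\<not> ?thesis"
    then have "d (\<xi> k) (\<alpha> * t k) \<le> d (\<xi> k) (u * \<tau> (\<xi> k))"
      using that(2) \<tau>[of k] \<xi>(2) by (intro d_antimono) auto
    with that show False by simp
  qed
  have "(\<lambda>k. d (\<xi> k) (1/2 * \<tau> (\<xi> k))) \<longlonglongrightarrow> 1"
    by (rule d_before_subseq[OF \<xi>(1)]) auto
  then have "\<forall>\<^sub>F k in sequentially. 1/2 < d (\<xi> k) (1/2 * \<tau> (\<xi> k))"
    by (rule order_tendstoD) simp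
  moreover have "\<forall>\<^sub>F k in sequentially. d (\<xi> k) (2 * t k) < 1/2"
    by (rule order_tendstoD[OF t0]) auto
  ultimately have lo: "\<forall>\<^sub>F k in sequentially. 1/4 \<le> R k"
  proof eventually_elim
    case (elim k)
    then have "1/2 * \<tau> (\<xi> k) < 2 * t k" by (intro order) auto
    then show ?case using \<tau>[of k] by (simp add: R_def field_simps)
  qed
  have "(\<lambda>k. d (\<xi> k) (5/2 * \<tau> (\<xi> k))) \<longlonglongrightarrow> 0"
    by (rule d_tendsto_0_if[OF \<xi>(1), of "5/2" 0]) (auto simp: B_sum_def E_set_0)
  then have "\<forall>\<^sub>F k in sequentially. d (\<xi> k) (5/2 * \<tau> (\<xi> k)) < 1/2"
    by (rule order_tendstoD) simp
  moreover have "\<forall>\<^sub>F k in sequentially. 1/2 < d (\<xi> k) (1/2 * t k)"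
    by (rule order_tendstoD[OF t1]) auto
  ultimately have hi: "\<forall>\<^sub>F k in sequentially. R k \<le> 5"
  proof eventually_elim
    case (elim k)
    then have "1/2 * t k < 5/2 * \<tau> (\<xi> k)" by (intro order') auto
    then show ?case using \<tau>[of k] by (simp add: R_def field_simps)
  qed
  \<comment> \<open>Every real sequence has a monotone subsequence, and a bounded monotone sequence converges.\<close>
  obtain f where f: "strict_mono f" and mono: "monoseq (\<lambda>k. R (f k))"
    using seq_monosub[of R] by blast
  have bnd: "\<forall>\<^sub>F k in sequentially. norm (R (f k)) \<le> 5"
    using eventually_compose_filterlim[OF hi filterlim_subseq[OF f]] R0
    by (simp add: less_imp_le)
  then have "Bseq (\<lambda>k. R (f k))"
    unfolding Bfun_def by (intro exI[of _ 5]) auto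
  then obtain \<rho> where \<rho>: "(\<lambda>k. R (f k)) \<longlonglongrightarrow> \<rho>"
    using Bseq_monoseq_convergent[OF _ mono] by (auto simp: convergent_def)
  have \<rho>0: "1/4 \<le> \<rho>"
    by (rule tendsto_lowerbound[OF \<rho> eventually_compose_filterlim[OF lo filterlim_subseq[OF f]]]) simp
  show ?thesis
  proof
    show "strict_mono f" "0 < \<rho>" using f \<rho>0 by auto
  next
    fix s assume s: "0 < s" "s < \<rho>"
    define \<alpha> where "\<alpha> = (s / \<rho> + 1) / 2"
    have \<alpha>: "0 < \<alpha>" "\<alpha> < 1" "s / \<alpha> < \<rho>" using s \<rho>0 by (auto simp: \<alpha>_def field_simps)
    have lim: "(\<lambda>k. d (\<xi> (f k)) (\<alpha> * t (f k))) \<longlonglongrightarrow> 1"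
      by (rule filterlim_compose[OF t1[OF \<alpha>(1,2)] filterlim_subseq[OF f]])
    show "(\<lambda>k. d (\<xi> (f k)) (s * \<tau> (\<xi> (f k)))) \<longlonglongrightarrow> 1"
    proof (rule tendsto_sandwich[OF _ _ lim tendsto_const])
      have "\<forall>\<^sub>F k in sequentially. s / \<alpha> < R (f k)"
        by (rule order_tendstoD(1)[OF \<rho> \<alpha>(3)])
      then show "\<forall>\<^sub>F k in sequentially. d (\<xi> (f k)) (\<alpha> * t (f k)) \<le> d (\<xi> (f k)) (s * \<tau> (\<xi> (f k)))"
      proof eventually_elim
        case (elim k)
        then have "s \<le> \<alpha> * R (f k)" using \<alpha> by (simp add: field_simps)
        then have "s * \<tau> (\<xi> (f k)) \<le> \<alpha> * R (f k) * \<tau> (\<xi> (f k))"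
          using \<tau>[of "f k"] by (intro mult_right_mono) auto
        then show ?case
          using s \<tau>[of "f k"] \<xi>(2) by (intro d_antimono) (auto simp: tR mult.assoc)
      qed
      have "d (\<xi> (f k)) (s * \<tau> (\<xi> (f k))) \<le> 1" for k
        using s \<tau>[of "f k"] by (intro d_le_1 \<xi>(2)) auto
      then show "\<forall>\<^sub>F k in sequentially. d (\<xi> (f k)) (s * \<tau> (\<xi> (f k))) \<le> 1"
        by simp
    qed
  next
    fix s assume s: "\<rho> < s"
    define \<alpha> where "\<alpha> = (s / \<rho> + 1) / 2"
    have "1 < s / \<rho>" using s \<rho>0 by simp
    have \<alpha>: "1 < \<alpha>" "\<alpha> < s / \<rho>" 
    proof -
      have "1 < x \<Longrightarrow> 1 < (x + 1) / 2 \<and> (x + 1) / 2 < x" for x :: real by auto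
      then show "1 < \<alpha>" "\<alpha> < s / \<rho>" unfolding \<alpha>_def using \<open>1 < s / \<rho>\<close> by blast+
    qed
    then have \<alpha>': "\<rho> < s / \<alpha>" using \<rho>0 by (simp add: field_simps)
    have lim: "(\<lambda>k. d (\<xi> (f k)) (\<alpha> * t (f k))) \<longlonglongrightarrow> 0"
      by (rule filterlim_compose[OF t0[OF \<alpha>(1)] filterlim_subseq[OF f]])
    show "(\<lambda>k. d (\<xi> (f k)) (s * \<tau> (\<xi> (f k)))) \<longlonglongrightarrow> 0"
    proof (rule tendsto_sandwich[OF _ _ tendsto_const lim])
      have "\<forall>\<^sub>F k in sequentially. R (f k) < s / \<alpha>"
        by (rule order_tendstoD(2)[OF \<rho> \<alpha>'])
      then show "\<forall>\<^sub>F k in sequentially. d (\<xi> (f k)) (s * \<tau> (\<xi> (f k))) \<le> d (\<xi> (f k)) (\<alpha> * t (f k))"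
      proof eventually_elim
        case (elim k)
        then have "\<alpha> * R (f k) \<le> s" using \<alpha> by (simp add: field_simps)
        then have "\<alpha> * R (f k) * \<tau> (\<xi> (f k)) \<le> s * \<tau> (\<xi> (f k))"
          using \<tau>[of "f k"] by (intro mult_right_mono) auto
        then show ?case
          using \<alpha> t[of "f k"] \<xi>(2) by (intro d_antimono) (auto simp: tR mult.assoc)
      qed
    qed (intro always_eventually allI d_nonneg)
  qed
qed

text \<open>
  With the cutoff at \<open>\<rho> \<tau>\<close>, necessarily \<open>1 \<le> \<rho> \<le> 2\<close>, and the two-sided estimates of the distance in terms of \<open>B\<^sub>\<delta>\<close> can
  be read backwards: \<open>d \<longlonglongrightarrow> 0\<close> forces \<open>B\<^sub>\<delta> \<longlonglongrightarrow> 0\<close>, and \<open>d \<longlonglongrightarrow> 1\<close> forces \<open>B\<^sub>\<delta>\<close> to infinity.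
\<close>

lemma threshold_if_cutoff:
  assumes \<xi>: "strict_mono \<xi>" "\<And>k. 2 \<le> \<xi> k" and cut: "has_tv_cutoff d \<xi>"
  obtains f D where "strict_mono f" "0 \<le> D" "D \<le> 1" "threshold (\<xi> \<circ> f) D"
proof -
  obtain f \<rho> where f: "strict_mono f" and \<rho>0: "0 < \<rho>"
    and before: "\<And>s. 0 < s \<Longrightarrow> s < \<rho> \<Longrightarrow> (\<lambda>k. d ((\<xi> \<circ> f) k) (s * \<tau> ((\<xi> \<circ> f) k))) \<longlonglongrightarrow> 1"
    and after: "\<And>s. \<rho> < s \<Longrightarrow> (\<lambda>k. d ((\<xi> \<circ> f) k) (s * \<tau> ((\<xi> \<circ> f) k))) \<longlonglongrightarrow> 0"
    by (rule cutoff_ratio[OF assms]) (auto simp: comp_def)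
  have \<xi>f: "strict_mono (\<xi> \<circ> f)" by (rule strict_mono_o[OF \<xi>(1) f])
  have "1 \<le> \<rho>"
  proof (rule ccontr)
    assume "\<not> 1 \<le> \<rho>"
    then obtain s where "\<rho> < s" "s < 1" using dense[of \<rho> 1] by auto
    then show False
      using LIMSEQ_unique[OF after[of s] d_before_subseq[OF \<xi>f, of s]] \<rho>0 by simp
  qed
  have "\<rho> \<le> 2"
  proof (rule ccontr)
    assume "\<not> \<rho> \<le> 2"
    then obtain s where s: "2 < s" "s < \<rho>" using dense[of 2 \<rho>] by auto
    then have "(\<lambda>k. d ((\<xi> \<circ> f) k) (s * \<tau> ((\<xi> \<circ> f) k))) \<longlonglongrightarrow> 0"
      by (intro d_tendsto_0_if[OF \<xi>f, of s 0]) (auto simp: B_sum_def E_set_0)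
    then show False
      using LIMSEQ_unique[OF _ before[of s]] s by fastforce
  qed
  define D where "D = 2 / \<rho> - 1"
  show ?thesis
  proof (rule that[OF f, of D])
    show "0 \<le> D" "D \<le> 1" using \<open>1 \<le> \<rho>\<close> \<open>\<rho> \<le> 2\<close> by (auto simp: D_def field_simps)
    show "threshold (\<xi> \<circ> f) D"
      unfolding threshold_def
    proof (intro ballI conjI impI)
      fix \<delta> :: real assume \<delta>: "\<delta> \<in> {0<..<1}" "\<delta> < D"
      then have "\<rho> < 2 / (1 + \<delta>)" using \<rho>0 by (simp add: D_def field_simps)
      then obtain s where s: "\<rho> < s" "s < 2 / (1 + \<delta>)" using dense by blast
      then have "s * (1 + \<delta>) < 2" using \<delta> by (simp add: field_simps)
      then show "(\<lambda>k. B ((\<xi> \<circ> f) k) \<delta>) \<longlonglongrightarrow> 0"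
        using s \<delta> \<open>1 \<le> \<rho>\<close> by (intro B_tendsto_0_if[OF \<xi>f _ _ _ after[OF s(1)]]) auto
    next
      fix \<delta> :: real assume \<delta>: "\<delta> \<in> {0<..<1}" "D < \<delta>"
      then have "2 / (1 + \<delta>) < \<rho>" using \<rho>0 by (simp add: D_def field_simps)
      then obtain s where s: "2 / (1 + \<delta>) < s" "s < \<rho>" using dense by blast
      moreover have "1 < 2 / (1 + \<delta>)" using \<delta> by (simp add: field_simps)
      ultimately have "1 < s" by simp
      moreover have "2 < s * (1 + \<delta>)" using s \<delta> by (simp add: field_simps)
      ultimately show "LIM k sequentially. B ((\<xi> \<circ> f) k) \<delta> :> at_top"
        using s \<delta> by (intro B_at_top_if[OF \<xi>f _ _ _ before]) auto
    qed
  qed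
qed

lemma Delta_not_less_if_threshold:
  assumes D: "0 \<le> D" "D \<le> 1" and th: "threshold \<xi> D"
  shows "\<not> Delta_zero_upper p b \<xi> < Delta_inf_upper p b \<xi>"
    and "\<not> Delta_zero_lower p b \<xi> < Delta_inf_lower p b \<xi>"
proof -
  have zero: "(\<lambda>k. ereal (B (\<xi> k) \<delta>)) \<longlonglongrightarrow> 0" if "\<delta> \<in> {0<..<1}" "\<delta> < D" for \<delta>
    using th that tendsto_ereal[of "\<lambda>k. B (\<xi> k) \<delta>" 0] by (simp add: threshold_def zero_ereal_def)
  have inf: "(\<lambda>k. ereal (B (\<xi> k) \<delta>)) \<longlonglongrightarrow> \<infinity>" if "\<delta> \<in> {0<..<1}" "D < \<delta>" for \<delta>
    using th that by (simp add: threshold_def tendsto_PInfty_eq_at_top)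
  show "\<not> Delta_zero_upper p b \<xi> < Delta_inf_upper p b \<xi>"
    unfolding Delta_zero_upper_def Delta_inf_upper_def
    by (rule Delta_not_less_if_jump[OF D]; unfold F_upper_def;
        rule lim_imp_Limsup[OF sequentially_bot]) (use zero inf in auto)
  show "\<not> Delta_zero_lower p b \<xi> < Delta_inf_lower p b \<xi>"
    unfolding Delta_zero_lower_def Delta_inf_lower_def
    by (rule Delta_not_less_if_jump[OF D]; unfold F_lower_def;
        rule lim_imp_Liminf[OF sequentially_bot]) (use zero inf in auto)
qed

lemma F_mono:
  assumes "strict_mono \<xi>" "\<delta> \<le> \<epsilon>"
  shows "F_upper p b \<xi> \<delta> \<le> F_upper p b \<xi> \<epsilon>" "F_lower p b \<xi> \<delta> \<le> F_lower p b \<xi> \<epsilon>"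
proof -
  have ev: "\<forall>\<^sub>F k in sequentially. ereal (B (\<xi> k) \<delta>) \<le> ereal (B (\<xi> k) \<epsilon>)"
    using eventually_ge_2[OF assms(1)] by eventually_elim (simp add: B_mono[OF _ assms(2)])
  show "F_upper p b \<xi> \<delta> \<le> F_upper p b \<xi> \<epsilon>" "F_lower p b \<xi> \<delta> \<le> F_lower p b \<xi> \<epsilon>"
    unfolding F_upper_def F_lower_def by (rule Limsup_mono[OF ev] Liminf_mono[OF ev])+
qed

lemma F_nonneg:
  assumes "strict_mono \<xi>"
  shows "0 \<le> F_upper p b \<xi> \<delta>" "0 \<le> F_lower p b \<xi> \<delta>"
proof -
  have ev: "\<forall>\<^sub>F k in sequentially. 0 \<le> ereal (B (\<xi> k) \<delta>)"
    using eventually_ge_2[OF assms] by eventually_elim (simp add: B_nonneg)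
  show "0 \<le> F_upper p b \<xi> \<delta>" "0 \<le> F_lower p b \<xi> \<delta>"
    unfolding F_upper_def F_lower_def by (rule le_Limsup[OF sequentially_bot ev] Liminf_bounded[OF ev])+
qed

text \<open>
  If the upper critical values are not separated, \<open>B\<close> tends to \<open>0\<close> below \<open>D\<close>, but above \<open>D\<close> it is only known to be
  unbounded.  A diagonal choice makes it tend to infinity for a sequence of \<open>\<delta>\<close> decreasing to \<open>D\<close>, and then, by
  monotonicity, for all \<open>\<delta> > D\<close>.
\<close>

lemma threshold_if_upper_not_less:
  assumes \<xi>: "strict_mono \<xi>" and nl: "\<not> Delta_zero_upper p b \<xi> < Delta_inf_upper p b \<xi>"
  obtains f D where "strict_mono f" "0 \<le> D" "D \<le> 1" "threshold (\<xi> \<circ> f) D"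
proof -
  obtain D where D: "0 \<le> D" "D \<le> 1"
    and zero: "\<And>\<delta>. \<delta> \<in> {0<..<1} \<Longrightarrow> \<delta> < D \<Longrightarrow> F_upper p b \<xi> \<delta> = 0"
    and inf: "\<And>\<delta>. \<delta> \<in> {0<..<1} \<Longrightarrow> D < \<delta> \<Longrightarrow> F_upper p b \<xi> \<delta> = \<infinity>"
    using jump_if_Delta_not_less[OF nl[unfolded Delta_zero_upper_def Delta_inf_upper_def]
        F_mono(1)[OF \<xi>] F_nonneg(1)[OF \<xi>]] by blast
  define \<epsilon> where "\<epsilon> j = D + (1 - D) / real (j + 2)" for j
  have \<epsilon>: "\<epsilon> \<longlonglongrightarrow> D"
  proof -
    have "(\<lambda>j. D + (1 - D) * (1 / real (j + 2))) \<longlonglongrightarrow> D + (1 - D) * 0"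
      by (intro tendsto_intros LIMSEQ_ignore_initial_segment[OF lim_1_over_n])
    then show ?thesis by (simp add: \<epsilon>_def[abs_def])
  qed
  \<comment> \<open>If \<open>D = 1\<close>, there is no admissible \<open>\<delta> > D\<close>, and every subsequence will do.\<close>
  have freq: "\<exists>\<^sub>F k in sequentially. D < 1 \<longrightarrow> real j \<le> B (\<xi> k) (\<epsilon> j)" for j
  proof (cases "D < 1")
    case True
    have "(1 - D) / real (j + 2) < 1 - D"
      using True divide_strict_left_mono[of 1 "real (j + 2)" "1 - D"] by simp
    moreover have "0 < (1 - D) / real (j + 2)" using True by simp
    ultimately have "F_upper p b \<xi> (\<epsilon> j) = \<infinity>"
      using D by (intro inf) (auto simp: \<epsilon>_def)
    show ?thesis
    proof (rule ccontr)
      assume "\<not> ?thesis"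
      then have "\<forall>\<^sub>F k in sequentially. ereal (B (\<xi> k) (\<epsilon> j)) \<le> ereal (real j)"
        using True by (auto simp: not_frequently elim: eventually_mono)
      then have "F_upper p b \<xi> (\<epsilon> j) \<le> ereal (real j)"
        unfolding F_upper_def by (rule Limsup_bounded)
      with \<open>F_upper p b \<xi> (\<epsilon> j) = \<infinity>\<close> show False by simp
    qed
  qed simp
  obtain f where f: "strict_mono f" and f_B: "\<And>j. D < 1 \<longrightarrow> real j \<le> B (\<xi> (f j)) (\<epsilon> j)"
    using diagonal_subsequence[of "\<lambda>j k. D < 1 \<longrightarrow> real j \<le> B (\<xi> k) (\<epsilon> j)", OF freq] by blast
  have \<xi>f: "strict_mono (\<xi> \<circ> f)" by (rule strict_mono_o[OF \<xi> f])
  show ?thesis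
  proof (rule that[OF f D], unfold threshold_def, intro ballI conjI impI)
    fix \<delta> :: real assume \<delta>: "\<delta> \<in> {0<..<1}" "\<delta> < D"
    have "(\<lambda>k. B (\<xi> k) \<delta>) \<longlonglongrightarrow> 0"
    proof (rule order_tendstoI)
      fix y :: real assume "y < 0"
      show "\<forall>\<^sub>F k in sequentially. y < B (\<xi> k) \<delta>"
        using eventually_ge_2[OF \<xi>]
      proof eventually_elim
        case (elim k)
        then show ?case using B_nonneg[of "\<xi> k" \<delta>] \<open>y < 0\<close> by simp
      qed
    next
      fix y :: real assume "0 < y"
      then have "limsup (\<lambda>k. ereal (B (\<xi> k) \<delta>)) < ereal y"
        using zero[OF \<delta>] by (simp add: F_upper_def)
      from Limsup_lessD[OF this] show "\<forall>\<^sub>F k in sequentially. B (\<xi> k) \<delta> < y" by simp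
    qed
    then show "(\<lambda>k. B ((\<xi> \<circ> f) k) \<delta>) \<longlonglongrightarrow> 0"
      unfolding comp_def using filterlim_subseq[OF f] by (rule filterlim_compose)
  next
    fix \<delta> :: real assume \<delta>: "\<delta> \<in> {0<..<1}" "D < \<delta>"
    show "LIM k sequentially. B ((\<xi> \<circ> f) k) \<delta> :> at_top"
    proof (rule filterlim_at_top_mono[OF filterlim_real_sequentially])
      have "\<forall>\<^sub>F j in sequentially. \<epsilon> j < \<delta>"
        by (rule order_tendstoD(2)[OF \<epsilon> \<delta>(2)])
      then show "\<forall>\<^sub>F j in sequentially. real j \<le> B ((\<xi> \<circ> f) j) \<delta>"
        using eventually_ge_2[OF \<xi>f]
      proof eventually_elim
        case (elim j)
        then have "B (\<xi> (f j)) (\<epsilon> j) \<le> B (\<xi> (f j)) \<delta>" by (intro B_mono) auto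
        then show ?case using f_B[of j] \<delta> by auto
      qed
    qed
  qed
qed

text \<open>
  If the lower critical values are not separated, \<open>B\<close> tends to infinity above \<open>D\<close>, but below \<open>D\<close> it only comes close to
  \<open>0\<close> infinitely often.  The diagonal choice is now made for a sequence of \<open>\<delta>\<close> increasing to \<open>D\<close>.
\<close>

lemma threshold_if_lower_not_less:
  assumes \<xi>: "strict_mono \<xi>" and nl: "\<not> Delta_zero_lower p b \<xi> < Delta_inf_lower p b \<xi>"
  obtains f D where "strict_mono f" "0 \<le> D" "D \<le> 1" "threshold (\<xi> \<circ> f) D"
proof -
  obtain D where D: "0 \<le> D" "D \<le> 1"
    and zero: "\<And>\<delta>. \<delta> \<in> {0<..<1} \<Longrightarrow> \<delta> < D \<Longrightarrow> F_lower p b \<xi> \<delta> = 0"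
    and inf: "\<And>\<delta>. \<delta> \<in> {0<..<1} \<Longrightarrow> D < \<delta> \<Longrightarrow> F_lower p b \<xi> \<delta> = \<infinity>"
    using jump_if_Delta_not_less[OF nl[unfolded Delta_zero_lower_def Delta_inf_lower_def]
        F_mono(2)[OF \<xi>] F_nonneg(2)[OF \<xi>]] by blast
  define \<epsilon> where "\<epsilon> j = D - D / real (j + 2)" for j
  have \<epsilon>: "\<epsilon> \<longlonglongrightarrow> D"
  proof -
    have "(\<lambda>j. D - D * (1 / real (j + 2))) \<longlonglongrightarrow> D - D * 0"
      by (intro tendsto_intros LIMSEQ_ignore_initial_segment[OF lim_1_over_n])
    then show ?thesis by (simp add: \<epsilon>_def[abs_def])
  qed
  \<comment> \<open>If \<open>D = 0\<close>, there is no admissible \<open>\<delta> < D\<close>, and every subsequence will do.\<close>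
  have freq: "\<exists>\<^sub>F k in sequentially. 0 < D \<longrightarrow> B (\<xi> k) (\<epsilon> j) \<le> 1 / real (Suc j)" for j
  proof (cases "0 < D")
    case True
    have "D / real (j + 2) < D"
      using True divide_strict_left_mono[of 1 "real (j + 2)" D] by simp
    moreover have "0 < D / real (j + 2)" using True by simp
    ultimately have "F_lower p b \<xi> (\<epsilon> j) = 0"
      using D by (intro zero) (auto simp: \<epsilon>_def)
    show ?thesis
    proof (rule ccontr)
      assume "\<not> ?thesis"
      then have "\<forall>\<^sub>F k in sequentially. ereal (1 / real (Suc j)) \<le> ereal (B (\<xi> k) (\<epsilon> j))"
        using True by (auto simp: not_frequently elim: eventually_mono)
      then have "ereal (1 / real (Suc j)) \<le> F_lower p b \<xi> (\<epsilon> j)"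
        unfolding F_lower_def by (rule Liminf_bounded)
      with \<open>F_lower p b \<xi> (\<epsilon> j) = 0\<close> show False by simp
    qed
  qed simp
  obtain f where f: "strict_mono f" and f_B: "\<And>j. 0 < D \<longrightarrow> B (\<xi> (f j)) (\<epsilon> j) \<le> 1 / real (Suc j)"
    using diagonal_subsequence[of "\<lambda>j k. 0 < D \<longrightarrow> B (\<xi> k) (\<epsilon> j) \<le> 1 / real (Suc j)", OF freq] by blast
  have \<xi>f: "strict_mono (\<xi> \<circ> f)" by (rule strict_mono_o[OF \<xi> f])
  show ?thesis
  proof (rule that[OF f D], unfold threshold_def, intro ballI conjI impI)
    fix \<delta> :: real assume \<delta>: "\<delta> \<in> {0<..<1}" "\<delta> < D"
    show "(\<lambda>k. B ((\<xi> \<circ> f) k) \<delta>) \<longlonglongrightarrow> 0"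
    proof (rule tendsto_sandwich[OF _ _ tendsto_const LIMSEQ_Suc[OF lim_1_over_n]])
      show "\<forall>\<^sub>F j in sequentially. 0 \<le> B ((\<xi> \<circ> f) j) \<delta>"
        using eventually_ge_2[OF \<xi>f] by eventually_elim (rule B_nonneg)
      have "\<forall>\<^sub>F j in sequentially. \<delta> < \<epsilon> j"
        by (rule order_tendstoD(1)[OF \<epsilon> \<delta>(2)])
      then show "\<forall>\<^sub>F j in sequentially. B ((\<xi> \<circ> f) j) \<delta> \<le> 1 / real (Suc j)"
        using eventually_ge_2[OF \<xi>f]
      proof eventually_elim
        case (elim j)
        then have "B (\<xi> (f j)) \<delta> \<le> B (\<xi> (f j)) (\<epsilon> j)" by (intro B_mono) auto
        then show ?case using f_B[of j] \<delta> by auto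
      qed
    qed
  next
    fix \<delta> :: real assume \<delta>: "\<delta> \<in> {0<..<1}" "D < \<delta>"
    have "LIM k sequentially. B (\<xi> k) \<delta> :> at_top"
      unfolding filterlim_at_top
    proof
      fix Z
      have "ereal Z < liminf (\<lambda>k. ereal (B (\<xi> k) \<delta>))"
        using inf[OF \<delta>] by (simp add: F_lower_def)
      from less_LiminfD[OF this] show "\<forall>\<^sub>F k in sequentially. Z \<le> B (\<xi> k) \<delta>"
        by (auto elim: eventually_mono)
    qed
    then show "LIM k sequentially. B ((\<xi> \<circ> f) k) \<delta> :> at_top"
      unfolding comp_def using filterlim_subseq[OF f] by (rule filterlim_compose)
  qed
qed

end

theorem corollary5p7:
  fixes p a b c :: "nat \<Rightarrow> nat \<Rightarrow> real"
    and \<pi> :: "nat \<Rightarrow> nat \<Rightarrow> nat \<Rightarrow> real"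
  assumes p_pos: "\<And>n i. 2 \<le> n \<Longrightarrow> i \<in> {1..n} \<Longrightarrow> 0 < p n i"
    and chain: "\<And>n i. 2 \<le> n \<Longrightarrow> i \<in> {1..n} \<Longrightarrow>
      irreducible_reversible_chain {0..2 * n} (param_kernel n (a n i) (b n i) (c n i)) (\<pi> n i)"
    and a_less_b: "\<And>n i. 2 \<le> n \<Longrightarrow> i \<in> {1..n} \<Longrightarrow> a n i < b n i"
    and a_plus_b: "\<And>n i. 2 \<le> n \<Longrightarrow> i \<in> {1..n} \<Longrightarrow> a n i + b n i < 1 / 2"
    and sum_a: "(\<lambda>n. \<Sum>i=1..n. a n i) \<in> o(\<lambda>n. 1 / real n)"
    and max_b: "(\<lambda>n. Max (b n ` {1..n})) \<in> o(\<lambda>n. 1)"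
    and max_ratio: "(\<lambda>n. Max ((\<lambda>i. a n i / b n i) ` {1..n})) \<in> O(\<lambda>n. 1 / real n)"
  defines "S1 \<equiv> \<forall>\<xi>. strict_mono \<xi> \<and> (\<forall>k. 1 \<le> \<xi> k) \<longrightarrow>
      Delta_zero_upper p b \<xi> < Delta_inf_upper p b \<xi> \<and>
      Delta_zero_lower p b \<xi> < Delta_inf_lower p b \<xi>"
    and "S2 \<equiv> \<forall>\<xi>. strict_mono \<xi> \<and> (\<forall>k. 1 \<le> \<xi> k) \<longrightarrow>
      Delta_zero_upper p b \<xi> < Delta_inf_upper p b \<xi> \<or>
      Delta_zero_lower p b \<xi> < Delta_inf_lower p b \<xi>"
    and "S3 \<equiv> \<forall>\<xi>. strict_mono \<xi> \<and> (\<forall>k. 2 \<le> \<xi> k) \<longrightarrow>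
      \<not> has_tv_cutoff (product_tv p a b c \<pi>) \<xi>"
  shows "(S1 \<longleftrightarrow> S2) \<and> (S2 \<longleftrightarrow> S3)"
proof -
  interpret detour_family p a b c \<pi>
    by (unfold_locales; fact p_pos chain a_less_b a_plus_b sum_a)
  have "S1 \<Longrightarrow> S2" unfolding S1_def S2_def by blast
  moreover have "S3" if S2
    unfolding S3_def
  proof (intro allI impI notI)
    fix \<xi> :: "nat \<Rightarrow> nat"
    assume \<xi>: "strict_mono \<xi> \<and> (\<forall>k. 2 \<le> \<xi> k)" and "has_tv_cutoff (product_tv p a b c \<pi>) \<xi>"
    then obtain f D where f: "strict_mono f" "0 \<le> D" "D \<le> 1" "threshold (\<xi> \<circ> f) D"
      using threshold_if_cutoff[of \<xi>] by blast
    have "strict_mono (\<xi> \<circ> f) \<and> (\<forall>k. 1 \<le> (\<xi> \<circ> f) k)"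
    proof (intro conjI allI)
      show "strict_mono (\<xi> \<circ> f)" using \<xi> f(1) by (intro strict_mono_o) auto
      have "2 \<le> \<xi> (f k)" for k using \<xi> by simp
      then show "1 \<le> (\<xi> \<circ> f) k" for k using order_trans[of 1 2 "\<xi> (f k)"] by simp
    qed
    then show False
      using \<open>S2\<close> Delta_not_less_if_threshold[OF f(2-4)] unfolding S2_def by blast
  qed
  moreover have "S1" if S3
    unfolding S1_def
  proof (intro allI impI, rule ccontr)
    fix \<xi> :: "nat \<Rightarrow> nat"
    assume \<xi>: "strict_mono \<xi> \<and> (\<forall>k. 1 \<le> \<xi> k)"
      and "\<not> (Delta_zero_upper p b \<xi> < Delta_inf_upper p b \<xi> \<and>
            Delta_zero_lower p b \<xi> < Delta_inf_lower p b \<xi>)"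
    then obtain f D where f: "strict_mono f" "0 \<le> D" "D \<le> 1" "threshold (\<xi> \<circ> f) D"
      using threshold_if_upper_not_less[of \<xi>] threshold_if_lower_not_less[of \<xi>] by blast
    \<comment> \<open>Dropping the first index leaves only indices at least \<open>2\<close>, where the chains are defined.\<close>
    define \<eta> where "\<eta> = (\<xi> \<circ> f) \<circ> Suc"
    have mono: "strict_mono (\<xi> \<circ> f)" using \<xi> f(1) by (intro strict_mono_o) auto
    have \<eta>: "strict_mono \<eta>" unfolding \<eta>_def by (rule strict_mono_o[OF mono]) (simp add: strict_mono_Suc_iff)
    have ge: "2 \<le> \<eta> k" for k
    proof -
      have "1 \<le> (\<xi> \<circ> f) k" using \<xi> by simp
      moreover have "(\<xi> \<circ> f) k < (\<xi> \<circ> f) (Suc k)" using mono by (simp add: strict_mono_Suc_iff)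
      ultimately show ?thesis by (simp add: \<eta>_def)
    qed
    have "threshold \<eta> D"
      unfolding \<eta>_def by (rule threshold_subseq[OF f(4)]) (simp add: strict_mono_Suc_iff)
    then have "has_tv_cutoff (product_tv p a b c \<pi>) \<eta>"
      by (intro cutoff_if_threshold[OF \<eta> ge f(2,3)])
    then show False using \<open>S3\<close> \<eta> ge unfolding S3_def by blast
  qed
  ultimately show ?thesis by blast
qed

end
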